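(* For every positive integer $m$, there are only finitely many strongly $s$-regular quaternary $\mathbb{Z}$-lattices $L$, up to isometry, such that $m_s(L)=m$.
   Context: A quaternary $\mathbb{Z}$-lattice is a positive definite $\mathbb{Z}$-lattice $L$ of rank $4$ on a quadratic space over $\mathbb{Q}$, with bilinear form $B$ and quadratic map $Q(x)=B(x,x)$, which is non-classic integral, i.e. the ideal of $\mathbb{Z}$ generated by $Q(L)$ is $\mathbb{Z}$. If $x_1,\dots,x_4$ is a basis of $L$, the discriminant is $dL=\det(2B(x_i,x_j))$ (the determinant of the matrix of second partial derivatives of the form $Q(\sum a_ix_i)$). For an integer $n\ge 0$, $r(n,L)=\#\{x\in L: Q(x)=n\}$. For a prime $p$, $\mu_p=\mathrm{ord}_p(n)$ and $h_p(dL,\mu)=\sum_{t=0}^{2\mu}\left(\frac{dL}{p}\right)^t p^t$ (Legendre symbol). $L$ is called strongly $s$-regular if for every positive integer $n$, writing $n=n_1n_2$ where every prime divisor of $n_1$ divides $2dL$ and $\gcd(n_2,2dL)=1$, one has $r(n_1^2n_2^2,L)=r(n_1^2,L)\prod_{p\nmid 2dL}h_p(dL,\mu_p)$, with $\mu_p=\mathrm{ord}_p(n)$. Finally $m_s(L)=\min\{n\in\mathbb{Z}_{>0}: r(n^2,L)\neq 0\}$. *)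

theory Defs
  imports "HOL-Analysis.Analysis" "HOL-Number_Theory.Number_Theory"
begin

text \<open>
  Every quadratic space of dimension 4 over \<open>\<rat>\<close> is isometric to \<open>\<rat>\<^sup>4\<close> with some symmetric
  bilinear form, so the ambient vector space is fixed and the form is a component of the object.
\<close>

record zlattice =
  bform :: "rat ^ 4 \<Rightarrow> rat ^ 4 \<Rightarrow> rat"
  points :: "(rat ^ 4) set"

definition qmap :: "zlattice \<Rightarrow> rat ^ 4 \<Rightarrow> rat" where
  "qmap L x = bform L x x"

definition symmetric_bilinear :: "(rat ^ 4 \<Rightarrow> rat ^ 4 \<Rightarrow> rat) \<Rightarrow> bool" where
  "symmetric_bilinear B \<longleftrightarrow>
     (\<forall>x y. B x y = B y x) \<and> (\<forall>x. Vector_Spaces.linear (*s) (*) (B x))"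

definition lattice_basis :: "zlattice \<Rightarrow> (4 \<Rightarrow> rat ^ 4) \<Rightarrow> bool" where
  "lattice_basis L b \<longleftrightarrow>
     inj b \<and> vec.independent (range b) \<and>
     points L = Modules.module.span (\<lambda>(k::int) x. of_int k *s x) (range b)"

text \<open>The last conjunct says that the ideal generated by the values of \<open>Q\<close> on \<open>L\<close> is \<open>\<int>\<close>.\<close>

definition quaternary_lattice :: "zlattice \<Rightarrow> bool" where
  "quaternary_lattice L \<longleftrightarrow>
     symmetric_bilinear (bform L) \<and>
     (\<forall>x. x \<noteq> 0 \<longrightarrow> qmap L x > 0) \<and>
     (\<exists>b. lattice_basis L b) \<and>
     Modules.module.span (\<lambda>(k::int) (q::rat). of_int k * q) (qmap L ` points L) = \<int>"

text \<open>
  The discriminant is an integer and does not depend on the basis; it is typed as an \<open>int\<close>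
  because it enters divisibility conditions and the Legendre symbol.
\<close>

definition lattice_disc :: "zlattice \<Rightarrow> int" where
  "lattice_disc L =
     (THE d. \<exists>b. lattice_basis L b \<and> of_int d = det (\<chi> i j. 2 * bform L (b i) (b j)))"

definition rep_num :: "nat \<Rightarrow> zlattice \<Rightarrow> nat" where
  "rep_num n L = card {x \<in> points L. qmap L x = of_nat n}"

definition h_factor :: "nat \<Rightarrow> int \<Rightarrow> nat \<Rightarrow> int" where
  "h_factor p d \<mu> = (\<Sum>t = 0..2 * \<mu>. Legendre d (int p) ^ t * int p ^ t)"

text \<open>
  The product over all primes \<open>p\<close> not dividing \<open>2dL\<close> is restricted to those dividing \<open>n\<close>:
  for the others the order of \<open>n\<close> at \<open>p\<close> is 0, and \<open>h_factor p d 0 = 1\<close>.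
\<close>

definition strongly_s_regular :: "zlattice \<Rightarrow> bool" where
  "strongly_s_regular L \<longleftrightarrow>
     (\<forall>n n1 n2 :: nat. n > 0 \<and> n = n1 * n2 \<and>
        (\<forall>p. prime p \<and> p dvd n1 \<longrightarrow> int p dvd 2 * lattice_disc L) \<and>
        coprime (int n2) (2 * lattice_disc L) \<longrightarrow>
        int (rep_num (n1\<^sup>2 * n2\<^sup>2) L) =
          int (rep_num (n1\<^sup>2) L) *
          (\<Prod>p | prime p \<and> p dvd n \<and> \<not> int p dvd 2 * lattice_disc L.
             h_factor p (lattice_disc L) (multiplicity p n)))"

text \<open>
  The minimum is over a set that is nonempty for every positive definite quaternary lattice;
  the value 0 in the other case only makes the function total.
\<close>

definition min_square :: "zlattice \<Rightarrow> nat" where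
  "min_square L =
     (if \<exists>n>0. rep_num (n\<^sup>2) L \<noteq> 0 then LEAST n. n > 0 \<and> rep_num (n\<^sup>2) L \<noteq> 0 else 0)"

definition lattice_isometry :: "(zlattice \<times> zlattice) set" where
  "lattice_isometry = {(L, M). \<exists>\<sigma>. Vector_Spaces.linear (*s) (*s) \<sigma> \<and> bij \<sigma> \<and>
     (\<forall>x y. bform M (\<sigma> x) (\<sigma> y) = bform L x y) \<and> \<sigma> ` points L = points M}"

lemma equiv_lattice_isometry: "equiv UNIV lattice_isometry"
proof (rule equivI)
  show "lattice_isometry \<subseteq> UNIV \<times> UNIV" by simp
  show "refl lattice_isometry"
    unfolding refl_on_def lattice_isometry_def
    by (auto intro!: exI[of _ id] simp: vec.linear_id)
  show "sym lattice_isometry"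
  proof (rule symI)
    fix L M assume "(L, M) \<in> lattice_isometry"
    then obtain s where s: "Vector_Spaces.linear (*s) (*s) s" "bij s"
      "\<And>x y. bform M (s x) (s y) = bform L x y" "s ` points L = points M"
      unfolding lattice_isometry_def by auto
    obtain g where g: "Vector_Spaces.linear (*s) (*s) g" "g \<circ> s = id"
      using vec.linear_injective_left_inverse[OF s(1) bij_is_inj[OF s(2)]] by blast
    then have gs: "g (s x) = x" for x by (simp add: pointfree_idE)
    then have sg: "s (g y) = y" for y using surjD[OF bij_is_surj[OF s(2)], of y] by auto
    have "bij g" by (rule o_bij[of s]) (simp_all add: fun_eq_iff gs sg)
    moreover have "bform L (g x) (g y) = bform M x y" for x y
      using s(3)[of "g x" "g y"] by (simp add: sg)
    moreover have "g ` points M = points L"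
      by (simp add: image_image gs flip: s(4))
    ultimately show "(M, L) \<in> lattice_isometry"
      unfolding lattice_isometry_def using g(1) by blast
  qed
  show "trans lattice_isometry"
  proof (rule transI)
    fix L M N assume "(L, M) \<in> lattice_isometry" "(M, N) \<in> lattice_isometry"
    then obtain s t where st: "Vector_Spaces.linear (*s) (*s) s" "bij s"
      "\<And>x y. bform M (s x) (s y) = bform L x y" "s ` points L = points M"
      "Vector_Spaces.linear (*s) (*s) t" "bij t"
      "\<And>x y. bform N (t x) (t y) = bform M x y" "t ` points M = points N"
      unfolding lattice_isometry_def by auto
    have "(t \<circ> s) ` points L = points N"
      using st(4,8) by (metis image_comp)
    moreover have "bform N ((t \<circ> s) x) ((t \<circ> s) y) = bform L x y" for x y
      using st(3,7) by simp
    ultimately show "(L, N) \<in> lattice_isometry"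
      unfolding lattice_isometry_def
      using Vector_Spaces.linear_compose[OF st(1,5)] bij_comp[OF st(2,6)] by blast
  qed
qed

end

theory Submission
  imports Defs "HOL-Computational_Algebra.Squarefree"
begin

text \<open>
  Let \<open>q\<close> be a prime not dividing \<open>2mdL\<close>. Comparing the regularity equations for \<open>m\<close> and \<open>qm\<close> shows
  that at least \<open>q\<^sup>2 - q + 1\<close> vectors of \<open>L\<close> satisfy \<open>Q(x) = q\<^sup>2m\<^sup>2\<close>. All of them are isotropic modulo
  \<open>q\<close>. Two such vectors \<open>y, z\<close> on the same line of \<open>L/qL\<close> have \<open>2B(y,z) \<in> q\<^sup>2\<int>\<close>, so this line
  carries a number of them bounded in terms of \<open>m\<close> alone; and a hyperplane of the nondegenerate space
  \<open>L/qL\<close> has only \<open>O(q)\<close> isotropic lines. Hence, for \<open>q\<close> large in terms of \<open>m\<close>, these vectors span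
  the whole space, and \<open>dL\<close> is at most a constant times \<open>(qm)\<^sup>8\<close>. As \<open>q\<close> may be taken to be the least
  admissible prime, \<open>dL\<close> is divisible by all the others below \<open>q\<close>, up to boundedly many, which
  is only possible for bounded \<open>q\<close>. So \<open>L\<close> contains four independent vectors of bounded length,
  and there are finitely many such lattices up to isometry.
\<close>

section \<open>Primes and finiteness\<close>

lemma card_le_fibres:
  assumes "finite B" "f ` A \<subseteq> B"
    and fib: "\<And>y. y \<in> B \<Longrightarrow> finite {x \<in> A. f x = y} \<and> card {x \<in> A. f x = y} \<le> n"
  shows "finite A \<and> card A \<le> card B * n"
proof -
  have A: "A = (\<Union>y\<in>B. {x \<in> A. f x = y})"
    using assms(2) by auto
  have "finite A"
    by (subst A) (use assms(1) fib in auto)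
  moreover have "card A \<le> (\<Sum>y\<in>B. card {x \<in> A. f x = y})"
    by (subst A) (rule card_UN_le[OF assms(1)])
  moreover have "\<dots> \<le> (\<Sum>y\<in>B. n)"
    by (rule sum_mono) (use fib in auto)
  ultimately show ?thesis by simp
qed

lemma squarefree_eq_prod_prime_factors:
  fixes a :: nat
  assumes "squarefree a"
  shows "a = \<Prod>(prime_factors a)"
proof -
  have a0: "a \<noteq> 0" using assms not_squarefree_0 by metis
  have "a = (\<Prod>p\<in>prime_factors a. p ^ multiplicity p a)"
    using prod_prime_factors[OF a0] by simp
  also have "\<dots> = (\<Prod>p\<in>prime_factors a. p)"
  proof (rule prod.cong[OF refl])
    fix p assume "p \<in> prime_factors a"
    then have "multiplicity p a = 1"
      using assms a0 squarefree_factorial_semiring'[of a] by auto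
    then show "p ^ multiplicity p a = p" by simp
  qed
  finally show ?thesis .
qed

text \<open>Erdos's argument: every \<open>n\<close> in \<open>{1..x}\<close> is a squarefree part
  times a square. With \<open>k\<close> primes up to \<open>x\<close> there are at most
  \<open>2 ^ k\<close> squarefree parts, and at most \<open>sqrt x\<close> square parts, so
  \<open>x \<le> 2 ^ k * sqrt x\<close>.\<close>

lemma le_four_power_card_primes:
  fixes x :: nat
  shows "x \<le> 4 ^ card {p. prime p \<and> p \<le> x}"
proof (cases "x = 0")
  case False
  define K where "K = {p. prime p \<and> p \<le> x}"
  define S where "S = {s. s > 0 \<and> s\<^sup>2 \<le> x}"
  define s where "s = Max S"
  have finK: "finite K"
    unfolding K_def by (rule finite_subset[of _ "{..x}"]) auto
  have S_le: "i \<le> x" if "i \<in> S" for i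
    using that power2_nat_le_imp_le unfolding S_def by blast
  have finS: "finite S"
    by (rule finite_subset[of _ "{..x}"]) (use S_le in auto)
  have "1 \<in> S" using False by (simp add: S_def)
  then have "s \<in> S" unfolding s_def using finS by (intro Max_in) auto
  have "S \<subseteq> {1..s}"
    unfolding s_def using finS by (auto simp: S_def Suc_le_eq)
  then have cardS: "card S \<le> s"
    using card_mono[of "{1..s}" S] by simp
  let ?f = "\<lambda>n::nat. (prime_factors (squarefree_part n), square_part n)"
  have "inj_on ?f {1..x}"
  proof (rule inj_onI)
    fix n m assume "?f n = ?f m"
    then have "squarefree_part n = squarefree_part m" "square_part n = square_part m"
      using squarefree_eq_prod_prime_factors[OF squarefree_squarefree_part, of n]
        squarefree_eq_prod_prime_factors[OF squarefree_squarefree_part, of m] by auto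
    then show "n = m" by (metis squarefree_decompose)
  qed
  moreover have "?f ` {1..x} \<subseteq> Pow K \<times> S"
  proof (clarify, intro conjI subsetI PowI)
    fix n p assume n: "n \<in> {1..x}" and "p \<in> prime_factors (squarefree_part n)"
    then have "prime p" "p dvd squarefree_part n" by auto
    moreover from this have "p dvd n"
      by (metis dvd_mult2 squarefree_decompose)
    ultimately show "p \<in> K" using n dvd_imp_le[of p n] by (auto simp: K_def)
  next
    fix n assume n: "n \<in> {1..x}"
    have "square_part n ^ 2 dvd n" by simp
    then have "square_part n ^ 2 \<le> n" using n by (intro dvd_imp_le) auto
    then show "square_part n \<in> S" using n by (auto simp: S_def intro!: Nat.gr0I)
  qed
  ultimately have "card {1..x} \<le> card (Pow K \<times> S)"
    using finK finS by (intro card_inj_on_le) auto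
  then have "x \<le> 2 ^ card K * s"
    using cardS by (simp add: card_cartesian_product card_Pow finK) (meson le_trans mult_le_mono2)
  \<comment> \<open>Squaring avoids real roots: \<open>s^2 \<le> x\<close> lets one factor
    \<open>x\<close> cancel at the end.\<close>
  then have "x\<^sup>2 \<le> (2 ^ card K * s)\<^sup>2"
    by (rule power_mono) simp
  also have "\<dots> = 4 ^ card K * s\<^sup>2"
    by (simp add: power2_eq_square flip: power_mult_distrib)
  also have "\<dots> \<le> 4 ^ card K * x"
    using \<open>s \<in> S\<close> by (simp add: S_def)
  finally show ?thesis using False by (simp add: power2_eq_square K_def)
qed simp

text \<open>The maximum of a set of positive integers is at least its cardinality; removing it gives
  the induction step.\<close>

lemma fact_card_le_prod:
  fixes S :: "nat set"
  assumes "finite S" "0 \<notin> S"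
  shows "fact (card S) \<le> \<Prod>S"
  using assms
proof (induction "card S" arbitrary: S)
  case (Suc k)
  let ?M = "Max S"
  have ne: "S \<noteq> {}" using Suc.hyps(2) by auto
  then have M: "?M \<in> S" using Suc.prems by simp
  have "S \<subseteq> {1..?M}"
    using Suc.prems by (auto simp: Suc_le_eq intro!: Nat.gr0I)
  then have "card S \<le> ?M" using card_mono[of "{1..?M}" S] by simp
  moreover have "fact (card (S - {?M})) \<le> \<Prod>(S - {?M})"
    using Suc M by (intro Suc.hyps) auto
  moreover have "\<Prod>S = ?M * \<Prod>(S - {?M})"
    using M Suc.prems by (simp add: prod.remove)
  moreover have "card S = Suc (card (S - {?M}))"
    using M Suc.prems Suc.hyps(2) by simp
  ultimately show ?case
    by (metis fact_Suc mult_le_mono of_nat_id)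
qed auto

text \<open>The terms \<open>c ^ k / k!\<close> of the exponential series tend to 0.\<close>

lemma eventually_power_less_fact:
  fixes C c :: nat
  shows "\<exists>k0. \<forall>k. fact k \<le> C * c ^ k \<longrightarrow> k \<le> k0"
proof -
  have "(\<lambda>k. real c ^ k / fact k) \<longlonglongrightarrow> 0"
    using summable_LIMSEQ_zero[OF summable_exp[of "real c"]] by (simp add: field_simps)
  then have "eventually (\<lambda>k. real c ^ k / fact k < 1 / real (C + 1)) sequentially"
    by (rule order_tendstoD) simp
  then obtain k0 where k0: "\<And>k. k \<ge> k0 \<Longrightarrow> real c ^ k / fact k < 1 / real (C + 1)"
    by (auto simp: eventually_sequentially)
  have "k \<le> k0" if "fact k \<le> C * c ^ k" for k
  proof (rule ccontr)
    assume "\<not> k \<le> k0"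
    then have "real c ^ k * real (C + 1) < fact k"
      using k0[of k] by (simp add: field_simps)
    then have "real (c ^ k * (C + 1)) < real (fact k)"
      by (simp only: of_nat_mult of_nat_power of_nat_fact)
    then have "c ^ k * (C + 1) < fact k" by linarith
    moreover have "C * c ^ k \<le> c ^ k * (C + 1)" by simp
    ultimately show False using that by linarith
  qed
  then show ?thesis by blast
qed

lemma prod_primes_dvd:
  fixes K :: "nat set"
  assumes "finite K" "\<And>p. p \<in> K \<Longrightarrow> prime p" "\<And>p. p \<in> K \<Longrightarrow> p dvd N"
  shows "\<Prod>K dvd N"
  using assms
proof (induction K rule: finite_induct)
  case (insert p K)
  have "coprime p (\<Prod>K)"
    using insert by (intro prod_coprime_right) (auto intro!: primes_coprime)
  then show ?case
    using insert by (simp add: divides_mult)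
qed simp

text \<open>
  All primes below the least admissible one divide \<open>q0! \<cdot> D\<close>, and the product of \<open>k\<close> primes is at
  least \<open>k!\<close>, while the prime following them is at most \<open>4 ^ k + 1\<close>.
\<close>
lemma small_prime_not_dvd:
  fixes C q0 j :: nat
  shows "\<exists>R. \<forall>D>0. \<exists>q. prime q \<and> q \<ge> q0 \<and> \<not> q dvd D \<and> (D \<le> C * q ^ j \<longrightarrow> q \<le> R)"
proof -
  obtain k0 where k0: "\<And>k. fact k \<le> (fact q0 * C * 8 ^ j) * (4 ^ j) ^ k \<Longrightarrow> k \<le> k0"
    using eventually_power_less_fact by meson
  have "\<exists>q. prime q \<and> q \<ge> q0 \<and> \<not> q dvd D \<and> (D \<le> C * q ^ j \<longrightarrow> q \<le> 8 * 4 ^ k0)"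
    if "D > 0" for D
  proof -
    define ok where "ok q \<longleftrightarrow> prime q \<and> q \<ge> q0 \<and> \<not> q dvd D" for q
    \<comment> \<open>A prime larger than \<open>D > 0\<close> cannot divide it, so admissible
      primes exist and a least one can be chosen.\<close>
    obtain p where "prime p" "p > max q0 D" using bigger_prime by blast
    then have "ok p" using \<open>D > 0\<close> nat_dvd_not_less by (auto simp: ok_def)
    define q where "q = (LEAST q. ok q)"
    have q: "ok q" unfolding q_def using \<open>ok p\<close> by (rule LeastI)
    have small: "\<not> ok r" if "r < q" for r using that not_less_Least q_def by blast
    define K where "K = {p. prime p \<and> p \<le> q - 1}"
    have finK: "finite K"
      unfolding K_def by (rule finite_subset[of _ "{..q}"]) auto
    have q2: "q \<ge> 2" using q prime_ge_2_nat by (auto simp: ok_def)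
    have dvd: "r dvd fact q0 * D" if "r \<in> K" for r
    proof -
      have r: "prime r" "r < q" using that q2 by (auto simp: K_def)
      then have "r < q0 \<or> r dvd D" using small[of r] by (auto simp: ok_def)
      moreover have "r dvd fact q0" if "r < q0"
        using that r prime_ge_1_nat[of r] by (intro dvd_fact) auto
      ultimately show ?thesis by auto
    qed
    have "\<Prod>K dvd fact q0 * D"
      using finK by (rule prod_primes_dvd) (use dvd in \<open>auto simp: K_def\<close>)
    have "q \<le> 8 * 4 ^ k0" if D: "D \<le> C * q ^ j"
    proof -
      have "q - 1 \<le> 4 ^ card K"
        using le_four_power_card_primes[of "q - 1"] by (simp add: K_def)
      \<comment> \<open>The generous factor 8 absorbs the summand 1 and keeps the bound purely
        multiplicative, ready for the \<open>j\<close>-th power.\<close>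
      then have q4: "q \<le> 8 * 4 ^ card K" using q2 by linarith
      have "fact (card K) \<le> \<Prod>K"
        using finK by (intro fact_card_le_prod) (auto simp: K_def)
      also have "\<dots> \<le> fact q0 * D"
        using \<open>\<Prod>K dvd fact q0 * D\<close> \<open>D > 0\<close> by (intro dvd_imp_le) auto
      also have "\<dots> \<le> fact q0 * (C * (8 * 4 ^ card K) ^ j)"
        using D q4 by (meson le_trans mult_le_mono2 power_mono zero_le)
      also have "\<dots> = (fact q0 * C * 8 ^ j) * (4 ^ j) ^ card K"
        by (simp add: power_mult_distrib mult.commute flip: power_mult)
      finally have "card K \<le> k0" by (rule k0)
      then have "(4::nat) ^ card K \<le> 4 ^ k0" by (intro power_increasing) auto
      then show ?thesis using q4 by linarith
    qed
    then show ?thesis using q by (auto simp: ok_def)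
  qed
  then show ?thesis by blast
qed

text \<open>Supplies the factorization that \<open>strongly_s_regular\<close> quantifies over, with
  \<open>d\<close> equal to twice the discriminant. Prime factors are sorted one at a time.\<close>

lemma split_coprime:
  fixes m :: nat and d :: int
  assumes "m > 0"
  shows "\<exists>m1 m2. m = m1 * m2 \<and> (\<forall>p. prime p \<and> p dvd m1 \<longrightarrow> int p dvd d) \<and> coprime (int m2) d"
  using assms
proof (induction m rule: prime_divisors_induct)
  case (unit x)
  then show ?case by (intro exI[of _ 1]) auto
next
  case (factor p x)
  then obtain m1 m2 where m: "x = m1 * m2" "\<And>p. prime p \<Longrightarrow> p dvd m1 \<Longrightarrow> int p dvd d"
    "coprime (int m2) d" by auto
  show ?case
  proof (cases "int p dvd d")
    case True
    then have "\<forall>r. prime r \<and> r dvd p * m1 \<longrightarrow> int r dvd d"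
      using m(2) factor(1) by (metis prime_dvd_mult_iff primes_dvd_imp_eq)
    then show ?thesis using m by (intro exI[of _ "p * m1"] exI[of _ m2]) auto
  next
    case False
    then have "coprime (int p) d" using factor(1) by (intro prime_imp_coprime) auto
    then show ?thesis using m by (intro exI[of _ m1] exI[of _ "p * m2"]) auto
  qed
qed auto

text \<open>A class is recovered from the value of \<open>f\<close> at any of its members in
  \<open>A\<close>, by choosing some element of \<open>A\<close> with that value.\<close>

lemma finite_quotient_invariant:
  assumes "equiv UNIV r" "finite (f ` A)"
    and inv: "\<And>x y. x \<in> A \<Longrightarrow> y \<in> A \<Longrightarrow> f x = f y \<Longrightarrow> (x, y) \<in> r"
  shows "finite (A // r)"
proof -
  define g where "g y = r `` {SOME x. x \<in> A \<and> f x = y}" for y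
  have "r `` {x} = g (f x)" if "x \<in> A" for x
  proof -
    have "(SOME z. z \<in> A \<and> f z = f x) \<in> A \<and> f (SOME z. z \<in> A \<and> f z = f x) = f x"
      by (rule someI[of _ x]) (use that in simp)
    then show ?thesis
      unfolding g_def using equiv_class_eq[OF assms(1)] inv that by metis
  qed
  then have "A // r \<subseteq> g ` (f ` A)"
    by (auto simp: quotient_def)
  then show ?thesis using assms(2) finite_surj by blast
qed

section \<open>Gram determinants\<close>

lemma det_Ints:
  fixes A :: "rat ^ 'n ^ 'n"
  assumes "\<And>i j. A $ i $ j \<in> \<int>"
  shows "det A \<in> \<int>"
  unfolding det_def using assms by (intro Ints_sum Ints_mult Ints_prod) auto

lemma det_bound:
  fixes A :: "rat ^ 'n ^ 'n"
  assumes "\<And>i j. \<bar>A $ i $ j\<bar> \<le> M"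
  shows "\<bar>det A\<bar> \<le> fact CARD('n) * M ^ CARD('n)"
proof -
  have "\<bar>det A\<bar> \<le> (\<Sum>p | p permutes (UNIV :: 'n set). \<bar>of_int (sign p) * (\<Prod>i\<in>UNIV. A $ i $ p i)\<bar>)"
    unfolding det_def by (rule sum_abs)
  also have "\<dots> \<le> (\<Sum>p | p permutes (UNIV :: 'n set). M ^ CARD('n))"
  proof (rule sum_mono)
    fix p :: "'n \<Rightarrow> 'n"
    have "\<bar>of_int (sign p) * (\<Prod>i\<in>UNIV. A $ i $ p i)\<bar> = (\<Prod>i\<in>UNIV. \<bar>A $ i $ p i\<bar>)"
      by (simp add: abs_mult abs_prod sign_def)
    also have "\<dots> \<le> (\<Prod>i\<in>(UNIV :: 'n set). M)"
      by (rule prod_mono) (use assms in auto)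
    finally show "\<bar>of_int (sign p) * (\<Prod>i\<in>UNIV. A $ i $ p i)\<bar> \<le> M ^ CARD('n)" by simp
  qed
  also have "\<dots> = fact CARD('n) * M ^ CARD('n)"
    by (simp add: card_permutations)
  finally show ?thesis .
qed

section \<open>Coordinates with respect to four independent vectors\<close>

definition cmb :: "(4 \<Rightarrow> rat ^ 4) \<Rightarrow> (4 \<Rightarrow> rat) \<Rightarrow> rat ^ 4" where
  "cmb v c = (\<Sum>i\<in>UNIV. c i *s v i)"

text \<open>Four independent vectors form an indexed basis of the rational space; they need not
  generate the lattice.\<close>

definition frame :: "(4 \<Rightarrow> rat ^ 4) \<Rightarrow> bool" where
  "frame v \<longleftrightarrow> inj v \<and> vec.independent (range v)"

lemma cmb_add: "cmb v (\<lambda>i. c i + e i) = cmb v c + cmb v e"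
  by (simp add: cmb_def vec.scale_left_distrib sum.distrib)

lemma cmb_diff: "cmb v (\<lambda>i. c i - e i) = cmb v c - cmb v e"
  by (simp add: cmb_def vec.scale_left_diff_distrib sum_subtractf)

lemma cmb_scale: "cmb v (\<lambda>i. r * c i) = r *s cmb v c"
  by (simp add: cmb_def vec.scale_sum_right)

lemma cmb_unit: "cmb v (\<lambda>i. if i = j then 1 else 0) = v j"
proof -
  have "cmb v (\<lambda>i. if i = j then 1 else 0) = (\<Sum>i\<in>UNIV. if i = j then v i else 0)"
    unfolding cmb_def by (rule sum.cong) auto
  then show ?thesis by simp
qed

lemma frame_sum:
  assumes "frame v"
  shows "(\<Sum>x\<in>range v. u x *s x) = cmb v (\<lambda>i. u (v i))"
  using assms unfolding frame_def cmb_def by (subst sum.reindex) auto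

lemma frame_zero:
  assumes "frame v" "cmb v c = 0"
  shows "c i = 0"
proof (rule ccontr)
  assume "c i \<noteq> 0"
  let ?u = "\<lambda>x. c (inv_into UNIV v x)"
  have inv: "inv_into UNIV v (v j) = j" for j using assms(1) by (simp add: frame_def)
  have "(\<Sum>x\<in>range v. ?u x *s x) = 0"
    using assms(2) by (simp add: frame_sum[OF assms(1)] inv)
  moreover have "\<exists>x\<in>range v. ?u x \<noteq> 0" using \<open>c i \<noteq> 0\<close> by (auto simp: inv)
  ultimately have "vec.dependent (range v)" by (subst vec.dependent_finite) auto
  then show False using assms(1) by (simp add: frame_def)
qed

lemma frame_cmb_inj:
  assumes "frame v" "cmb v c = cmb v e"
  shows "c = e"
proof
  fix i
  have "cmb v (\<lambda>i. c i - e i) = 0" using assms(2) by (simp add: cmb_diff)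
  from frame_zero[OF assms(1) this, of i] show "c i = e i" by simp
qed

lemma frame_cmb_ex:
  assumes "frame v"
  obtains c where "x = cmb v c"
proof -
  have "card (range v) = CARD(4)" using assms by (simp add: frame_def card_image)
  then have "UNIV \<subseteq> vec.span (range v)"
    using assms by (intro vec.card_ge_dim_independent) (auto simp: frame_def card_cart_basis)
  then have "x \<in> range (\<lambda>u. \<Sum>y\<in>range v. u y *s y)"
    by (simp flip: vec.span_finite) blast
  then show ?thesis using that frame_sum[OF assms] by auto
qed

interpretation int_module: Modules.module "\<lambda>(k::int) (x::rat ^ 4). of_int k *s x"
  by unfold_locales (simp_all add: vec.scale_left_distrib vec.scale_right_distrib)

interpretation int_module_rat: Modules.module "\<lambda>(k::int) (x::rat). of_int k * x"
  by unfold_locales (simp_all add: algebra_simps)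

lemma lattice_basis_frame: "lattice_basis L b \<Longrightarrow> frame b"
  by (simp add: lattice_basis_def frame_def)

lemma lattice_basis_points:
  assumes "lattice_basis L b"
  shows "x \<in> points L \<longleftrightarrow> (\<exists>k. x = cmb b (\<lambda>i. of_int (k i)))"
proof -
  have inj: "inj b" using assms by (simp add: lattice_basis_def)
  have P: "points L = range (\<lambda>u. \<Sum>y\<in>range b. of_int (u y) *s y)"
    using assms by (simp add: lattice_basis_def int_module.span_finite)
  show ?thesis
  proof
    assume "x \<in> points L"
    then obtain u where "x = (\<Sum>y\<in>range b. of_int (u y) *s y)" using P by auto
    then have "x = cmb b (\<lambda>i. of_int (u (b i)))"
      using inj by (simp add: cmb_def sum.reindex)
    then show "\<exists>k. x = cmb b (\<lambda>i. of_int (k i))" by (intro exI[of _ "\<lambda>i. u (b i)"])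
  next
    assume "\<exists>k. x = cmb b (\<lambda>i. of_int (k i))"
    then obtain k where "x = cmb b (\<lambda>i. of_int (k i))" by blast
    then have "x = (\<Sum>y\<in>range b. of_int (k (inv_into UNIV b y)) *s y)"
      using inj by (simp add: cmb_def sum.reindex)
    then show "x \<in> points L" unfolding P by (intro range_eqI[of _ _ "\<lambda>y. k (inv_into UNIV b y)"])
  qed
qed

section \<open>Positive definite lattices, Gram matrices and the discriminant\<close>

locale quat_lattice =
  fixes L :: zlattice
  assumes quat: "quaternary_lattice L"
begin

abbreviation "B \<equiv> bform L"
abbreviation "Q \<equiv> qmap L"
abbreviation "P \<equiv> points L"
abbreviation "d \<equiv> lattice_disc L"

lemma B_sym: "B x y = B y x"
  using quat by (simp add: quaternary_lattice_def symmetric_bilinear_def)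

lemma B_add_right: "B x (y + z) = B x y + B x z"
  and B_scale_right: "B x (r *s y) = r * B x y"
proof -
  have "Vector_Spaces.linear (*s) (*) (B x)"
    using quat by (simp add: quaternary_lattice_def symmetric_bilinear_def)
  then show "B x (y + z) = B x y + B x z" "B x (r *s y) = r * B x y"
    by (simp_all add: Vector_Spaces.linear_iff)
qed

lemma B_add_left: "B (y + z) x = B y x + B z x"
  and B_scale_left: "B (r *s y) x = r * B y x"
  using B_add_right B_scale_right by (simp_all add: B_sym[of _ x])

lemma B_zero_right [simp]: "B x 0 = 0"
  using B_scale_right[of x 0 0] by simp

lemma B_minus_right: "B x (- y) = - B x y"
  using B_add_right[of x y "- y"] by simp

lemma B_diff_right: "B x (y - z) = B x y - B x z"
  using B_add_right[of x y "- z"] by (simp add: B_minus_right)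

lemma B_diff_left: "B (y - z) x = B y x - B z x"
  using B_diff_right by (simp add: B_sym[of _ x])

lemmas B_simps = B_add_left B_add_right B_scale_left B_scale_right B_diff_left B_diff_right

lemma B_sum_right: "B x (\<Sum>i\<in>I. f i) = (\<Sum>i\<in>I. B x (f i))"
  by (induction I rule: infinite_finite_induct) (simp_all add: B_add_right)

lemma B_cmb: "B x (cmb v c) = (\<Sum>i\<in>UNIV. c i * B x (v i))"
  by (simp add: cmb_def B_sum_right B_scale_right)

lemma Q_def: "Q x = B x x"
  by (simp add: qmap_def)

lemma Q_add: "Q (x + y) = Q x + 2 * B x y + Q y"
  by (simp add: Q_def B_simps B_sym[of y x])

lemma Q_scale: "Q (r *s x) = r\<^sup>2 * Q x"
  by (simp add: Q_def B_simps power2_eq_square)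

lemma Q_zero [simp]: "Q 0 = 0"
  by (simp add: Q_def)

lemma Q_pos: "x \<noteq> 0 \<Longrightarrow> Q x > 0"
  using quat by (simp add: quaternary_lattice_def)

lemma Q_eq_0: "Q x = 0 \<longleftrightarrow> x = 0"
  using Q_pos[of x] by (metis Q_zero less_irrefl)

lemma Q_nonneg: "Q x \<ge> 0"
  using Q_pos[of x] by (cases "x = 0") auto

text \<open>\<open>Q\<close> is nonnegative at \<open>x + y\<close> and \<open>x - y\<close>. This
  replaces Cauchy-Schwarz and needs no square roots.\<close>

lemma B_bound: "\<bar>2 * B x y\<bar> \<le> Q x + Q y"
proof -
  have "Q (x - y) = Q x - 2 * B x y + Q y"
    by (simp add: Q_def B_simps B_sym[of y x])
  then show ?thesis
    using Q_nonneg[of "x + y"] Q_nonneg[of "x - y"] unfolding Q_add by linarith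
qed

lemma basis_ex: obtains b where "lattice_basis L b"
  using quat by (auto simp: quaternary_lattice_def)

lemma P_add: "x \<in> P \<Longrightarrow> y \<in> P \<Longrightarrow> x + y \<in> P"
  and P_scale: "x \<in> P \<Longrightarrow> of_int k *s x \<in> P"
  and P_diff: "x \<in> P \<Longrightarrow> y \<in> P \<Longrightarrow> x - y \<in> P"
  and P_zero: "0 \<in> P"
proof -
  obtain b where "lattice_basis L b" by (rule basis_ex)
  then have P: "P = int_module.span (range b)" by (simp add: lattice_basis_def)
  show "x \<in> P \<Longrightarrow> y \<in> P \<Longrightarrow> x + y \<in> P" "x \<in> P \<Longrightarrow> of_int k *s x \<in> P"
    "x \<in> P \<Longrightarrow> y \<in> P \<Longrightarrow> x - y \<in> P" "0 \<in> P"
    unfolding P by (auto intro: int_module.span_add int_module.span_scale int_module.span_diff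
      int_module.span_zero)
qed

lemma P_sum: "(\<And>i. i \<in> I \<Longrightarrow> f i \<in> P) \<Longrightarrow> (\<Sum>i\<in>I. f i) \<in> P"
  by (induction I rule: infinite_finite_induct) (simp_all add: P_add P_zero)

lemma P_cmb: "(\<And>i. v i \<in> P) \<Longrightarrow> cmb v (\<lambda>i. of_int (k i)) \<in> P"
  unfolding cmb_def by (intro P_sum P_scale)

lemma Q_Ints: "x \<in> P \<Longrightarrow> Q x \<in> \<int>"
  using quat int_module_rat.span_superset[of "Q ` P"] by (auto simp: quaternary_lattice_def)

lemma B_Ints:
  assumes "x \<in> P" "y \<in> P"
  shows "2 * B x y \<in> \<int>"
proof -
  have "2 * B x y = Q (x + y) - Q x - Q y" by (simp add: Q_add)
  then show ?thesis using assms by (auto intro!: Ints_diff Q_Ints P_add)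
qed

definition gram :: "(4 \<Rightarrow> rat ^ 4) \<Rightarrow> rat ^ 4 ^ 4" where
  "gram v = (\<chi> i j. 2 * B (v i) (v j))"

lemma gram_mult: "(gram v *v (\<chi> i. c i)) $ i = 2 * B (v i) (cmb v c)"
  by (simp add: gram_def matrix_vector_mult_def B_cmb sum_distrib_left mult_ac)

text \<open>A combination of the \<open>v i\<close> that is orthogonal to all of them is orthogonal
  to itself, so positive definiteness applies.\<close>

lemma B_frame_eq_0:
  assumes "\<And>i. B (v i) (cmb v c) = 0"
  shows "cmb v c = 0"
proof -
  have "Q (cmb v c) = (\<Sum>i\<in>UNIV. c i * B (cmb v c) (v i))"
    unfolding Q_def by (rule B_cmb)
  also have "\<dots> = 0" using assms by (simp add: B_sym)
  finally show ?thesis by (simp add: Q_eq_0)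
qed

lemma det_gram_nonzero:
  assumes "frame v"
  shows "det (gram v) \<noteq> 0"
proof -
  have "x = 0" if "gram v *v x = 0" for x
  proof -
    have "2 * B (v i) (cmb v (\<lambda>j. x $ j)) = 0" for i
      using gram_mult[of v "\<lambda>j. x $ j" i] that by simp
    then have "cmb v (\<lambda>j. x $ j) = 0" by (intro B_frame_eq_0) simp
    then show ?thesis using frame_zero[OF assms] by (auto simp: vec_eq_iff)
  qed
  then have "invertible (gram v)"
    using matrix_left_invertible_ker[of "gram v"] by (auto simp: invertible_left_inverse)
  then show ?thesis by (simp add: invertible_det_nz)
qed

lemma gram_cmb:
  assumes "\<And>i. v i = cmb b (\<lambda>j. T $ i $ j)"
  shows "gram v = T ** gram b ** transpose T"
proof -
  have "2 * B (v i) (v j) = (T ** gram b ** transpose T) $ i $ j" for i j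
  proof -
    have "2 * B (v i) (v j) = 2 * (\<Sum>l\<in>UNIV. T $ j $ l * B (v i) (b l))"
      using B_cmb[of "v i" b "\<lambda>l. T $ j $ l"] by (simp flip: assms)
    also have "\<dots> = (\<Sum>l\<in>UNIV. \<Sum>k\<in>UNIV. T $ j $ l * (T $ i $ k * (2 * B (b l) (b k))))"
      using B_cmb[of _ b "\<lambda>l. T $ i $ l"]
      by (simp add: B_sym[of "v i"] sum_distrib_left mult_ac flip: assms)
    also have "\<dots> = (T ** gram b ** transpose T) $ i $ j"
      by (simp add: matrix_matrix_mult_def transpose_def gram_def sum_distrib_left sum_distrib_right
        B_sym mult_ac)
    finally show ?thesis .
  qed
  then show ?thesis by (simp add: gram_def vec_eq_iff)
qed

lemma det_gram_cmb:
  assumes "\<And>i. v i = cmb b (\<lambda>j. T i j)"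
  shows "det (gram v) = (det (\<chi> i j. T i j))\<^sup>2 * det (gram b)"
proof -
  have "gram v = (\<chi> i j. T i j) ** gram b ** transpose (\<chi> i j. T i j)"
    by (rule gram_cmb) (simp add: assms)
  then show ?thesis by (simp add: det_mul power2_eq_square mult_ac)
qed

text \<open>Here \<open>t\<close> is the determinant of the integral coordinate matrix of
  \<open>v\<close> with respect to \<open>b\<close>; if nonzero, it is up to sign the index of the
  sublattice spanned by \<open>v\<close>.\<close>

lemma det_gram_points:
  assumes "lattice_basis L b" "\<And>i. v i \<in> P"
  obtains t :: int where "det (gram v) = of_int (t\<^sup>2) * det (gram b)"
proof -
  have "\<forall>i. \<exists>k. v i = cmb b (\<lambda>j. of_int (k j))"
    using assms(2) lattice_basis_points[OF assms(1)] by blast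
  then obtain T where T: "\<And>i. v i = cmb b (\<lambda>j. of_int (T i j :: int))" by metis
  have "det ((\<chi> i j. of_int (T i j)) :: rat ^ 4 ^ 4) \<in> \<int>" by (rule det_Ints) simp
  then obtain t where "det ((\<chi> i j. of_int (T i j)) :: rat ^ 4 ^ 4) = of_int t" by (auto elim: Ints_cases)
  then show ?thesis using that[of t] det_gram_cmb[of v b "\<lambda>i j. of_int (T i j)"] T by simp
qed

lemma lattice_basis_in_P: "lattice_basis L b \<Longrightarrow> b i \<in> P"
  by (auto simp: lattice_basis_def int_module.span_superset intro!: int_module.span_base)

text \<open>Justifies the definite description in \<open>lattice_disc\<close>: the Gram determinants
  of two bases are integral squares \<open>t^2\<close>, \<open>s^2\<close> times each other, hence
  \<open>t^2 * s^2 = 1\<close>. Integrality of the entries \<open>2 * B\<close> makes the common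
  value an integer.\<close>

lemma disc_det:
  assumes b: "lattice_basis L b"
  shows "of_int d = det (gram b)"
proof -
  have same: "det (gram v) = det (gram b)" if v: "lattice_basis L v" for v
  proof -
    obtain t where t: "det (gram v) = of_int (t\<^sup>2) * det (gram b)"
      using det_gram_points[OF b lattice_basis_in_P[OF v]] .
    obtain s where s: "det (gram b) = of_int (s\<^sup>2) * det (gram v)"
      using det_gram_points[OF v lattice_basis_in_P[OF b]] .
    have "det (gram v) = of_int (t\<^sup>2) * (of_int (s\<^sup>2) * det (gram v))"
      using t unfolding s .
    then have "of_int (t\<^sup>2 * s\<^sup>2) * det (gram v) = 1 * det (gram v)"
      by (simp add: mult.assoc)
    then have "of_int (t\<^sup>2 * s\<^sup>2) = (1 :: rat)"
      using det_gram_nonzero[OF lattice_basis_frame[OF v]] by (simp only: mult_cancel_right) simp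
    then have "t\<^sup>2 * s\<^sup>2 = 1" by (simp only: of_int_eq_1_iff)
    then have "t\<^sup>2 = 1" using zero_le_power2[of t] unfolding zmult_eq_1_iff by linarith
    then show ?thesis using t by simp
  qed
  have "det (gram b) \<in> \<int>"
    by (rule det_Ints) (simp add: gram_def B_Ints lattice_basis_in_P[OF b])
  then obtain e where e: "det (gram b) = of_int e" by (auto elim: Ints_cases)
  have "d = e"
    unfolding lattice_disc_def
  proof (rule the_equality)
    show "\<exists>b. lattice_basis L b \<and> of_int e = det (\<chi> i j. 2 * B (b i) (b j))"
      using b e by (auto simp: gram_def)
    show "e' = e" if "\<exists>b. lattice_basis L b \<and> of_int e' = det (\<chi> i j. 2 * B (b i) (b j))" for e'
      using that same e by (auto simp flip: gram_def)
  qed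
  then show ?thesis using e by simp
qed

lemma disc_nonzero: "d \<noteq> 0"
proof -
  obtain b where b: "lattice_basis L b" by (rule basis_ex)
  show ?thesis
    using disc_det[OF b] det_gram_nonzero[OF lattice_basis_frame[OF b]] by auto
qed

text \<open>Cramer's rule: the product is the determinant of an integral matrix,
  \<open>gram v\<close> with column \<open>k\<close> replaced by the pairings with
  \<open>cmb v c\<close>. It serves both for nondegeneracy modulo \<open>q\<close> and for bounding
  denominators of coordinates.\<close>

lemma gram_cramer:
  assumes "\<And>i j. 2 * B (v i) (v j) \<in> \<int>" "\<And>i. 2 * B (v i) (cmb v c) \<in> \<int>"
  shows "c k * det (gram v) \<in> \<int>"
proof -
  have "det (\<chi> i j. if j = k then (gram v *v (\<chi> i. c i)) $ i else gram v $ i $ j) \<in> \<int>"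
    by (rule det_Ints) (auto simp: gram_mult, auto simp: gram_def assms)
  then show ?thesis unfolding cramer_lemma by simp
qed

text \<open>The Gram determinant of \<open>v\<close> is a nonzero square times the discriminant, and
  its entries are at most \<open>2 * M\<close> in absolute value; 24 is the number of terms in the
  Leibniz formula.\<close>

lemma disc_le:
  assumes v: "frame v" "\<And>i. v i \<in> P" and M: "\<And>i. Q (v i) \<le> M"
  shows "of_int \<bar>d\<bar> \<le> 24 * (2 * M) ^ 4"
proof -
  obtain b where b: "lattice_basis L b" by (rule basis_ex)
  obtain t where "det (gram v) = of_int (t\<^sup>2) * det (gram b)"
    using det_gram_points[OF b v(2)] .
  then have t: "det (gram v) = of_int (t\<^sup>2) * of_int d" unfolding disc_det[OF b] .
  then have "t \<noteq> 0" using det_gram_nonzero[OF v(1)] by auto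
  then have "t\<^sup>2 \<ge> 1" by (simp add: int_one_le_iff_zero_less)
  then have "\<bar>d\<bar> \<le> t\<^sup>2 * \<bar>d\<bar>" using mult_right_mono[of 1 "t\<^sup>2" "\<bar>d\<bar>"] by simp
  then have "(of_int \<bar>d\<bar> :: rat) \<le> of_int (t\<^sup>2 * \<bar>d\<bar>)" by (simp only: of_int_le_iff)
  also have "\<dots> = \<bar>det (gram v)\<bar>" using t by (simp add: abs_mult)
  also have "\<dots> \<le> fact CARD(4) * (2 * M) ^ CARD(4)"
  proof (rule det_bound)
    fix i j show "\<bar>gram v $ i $ j\<bar> \<le> 2 * M"
      using B_bound[of "v i" "v j"] M[of i] M[of j] by (simp add: gram_def)
  qed
  finally show ?thesis by (simp add: fact_numeral)
qed

end

section \<open>Isotropic vectors in a hyperplane modulo a prime\<close>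

text \<open>Models \<open>Q\<close> and its polar form \<open>2B\<close> in lattice coordinates. The
  polar form is used because \<open>B\<close> itself may take half-integral values.\<close>

locale integral_form =
  fixes qf :: "int ^ 4 \<Rightarrow> int" and bf :: "int ^ 4 \<Rightarrow> int ^ 4 \<Rightarrow> int"
  assumes bf_add: "bf x (y + z) = bf x y + bf x z"
    and bf_scale: "bf x (c *s y) = c * bf x y"
    and bf_sym: "bf x y = bf y x"
    and qf_add: "qf (x + y) = qf x + bf x y + qf y"
    and qf_scale: "qf (c *s x) = c\<^sup>2 * qf x"
begin

lemma bf_scale_left: "bf (c *s x) z = c * bf x z"
  using bf_scale by (simp add: bf_sym[of _ z])

lemma bf_diff: "bf x (y - z) = bf x y - bf x z"
  using bf_add[of x "y - z" z] by simp

lemma bf_diff_left: "bf (x - y) z = bf x z - bf y z"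
  using bf_diff by (simp add: bf_sym[of _ z])

lemma bf_self: "bf x x = 2 * qf x"
proof -
  have "x + x = 2 *s x" by (simp add: vec_eq_iff)
  then show ?thesis using qf_add[of x x] qf_scale[of 2 x] by simp
qed

end

lemma int_vec_dvd:
  fixes v :: "int ^ 4"
  assumes "\<And>i. q dvd v $ i"
  obtains w where "v = q *s w"
proof
  show "v = q *s (\<chi> i. v $ i div q)" using assms by (simp add: vec_eq_iff)
qed

text \<open>The last assumption says that the polar form has trivial radical modulo
  \<open>q\<close>.\<close>

locale integral_form_mod = integral_form +
  fixes q :: int
  assumes prime_q: "prime q"
    and nondeg: "(\<And>y. q dvd bf u y) \<Longrightarrow> q dvd u $ i"
begin

lemma prime_dvd_mult: "q dvd a * b \<longleftrightarrow> q dvd a \<or> q dvd b"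
  using prime_q by (simp add: prime_dvd_mult_iff)

lemma q_gt_1: "q > 1"
  using prime_q prime_gt_1_int by blast

text \<open>Otherwise a hyperplane would be totally isotropic modulo \<open>q\<close>, but a
  nondegenerate space of dimension 4 has no totally isotropic subspace of dimension 3.\<close>

lemma kernel_not_isotropic:
  assumes f_add: "\<And>x y. f (x + y) = f x + f y" and f_scale: "\<And>c x. f (c *s x) = c * f x"
    and j: "\<not> q dvd f (axis j 1)"
  obtains h where "f h = 0" "\<not> q dvd qf h"
proof -
  have "\<exists>h. f h = 0 \<and> \<not> q dvd qf h"
  proof (rule ccontr)
    assume "\<not> ?thesis"
    then have iso: "q dvd qf h" if "f h = 0" for h using that by blast
    have f_diff: "f (x - y) = f x - f y" for x y using f_add[of "x - y" y] by simp
    define e :: "int ^ 4" where "e = axis j 1"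
    have perp: "q dvd bf u v" if "f u = 0" "f v = 0" for u v
    proof -
      have "bf u v = qf (u + v) - qf u - qf v" by (simp add: qf_add)
      then show ?thesis using that by (auto intro!: dvd_diff iso simp: f_add)
    qed
    \<comment> \<open>Modulo the kernel of \<open>f\<close>, the vector \<open>f e *s y\<close> is a
      multiple of \<open>e\<close>. So a kernel vector orthogonal to \<open>e\<close> modulo
      \<open>q\<close> is orthogonal to everything, as \<open>q\<close> does not divide
      \<open>f e\<close>.\<close>
    have rad: "q dvd u $ i" if "f u = 0" "q dvd bf u e" for u i
    proof (rule nondeg)
      fix y
      have "q dvd bf u (f e *s y - f y *s e)"
        using that(1) by (intro perp) (simp_all add: f_diff f_scale)
      then have "q dvd f e * bf u y - f y * bf u e" by (simp add: bf_diff bf_scale)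
      then have "q dvd f e * bf u y"
        using that(2) by (metis dvd_add_left_iff dvd_mult diff_add_cancel)
      then show "q dvd bf u y" using j by (simp add: prime_dvd_mult e_def)
    qed
    have "card (UNIV - {j}) = 3" by (simp add: card_Diff_singleton)
    then obtain i k l where "UNIV - {j} = {i, k, l}" and "i \<noteq> k"
      unfolding card_3_iff by blast
    then have ik: "i \<noteq> j" "k \<noteq> j" "i \<noteq> k" by blast+
    \<comment> \<open>Kernel vectors \<open>u\<close>, \<open>v\<close> and their combination
      \<open>w\<close> orthogonal to \<open>e\<close>. Coordinate \<open>i\<close> of
      \<open>w\<close> is \<open>bf v e * f e\<close>, so \<open>rad\<close> gives
      \<open>q dvd bf v e\<close>; applied to \<open>v\<close>, it then contradicts that coordinate
      \<open>k\<close> of \<open>v\<close> is \<open>f e\<close>.\<close>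
    define u where "u = f e *s axis i 1 - f (axis i 1) *s e"
    define v where "v = f e *s axis k 1 - f (axis k 1) *s e"
    define w where "w = bf v e *s u - bf u e *s v"
    have uv: "f u = 0" "f v = 0" by (simp_all add: u_def v_def f_diff f_scale)
    have "q dvd w $ i"
      by (rule rad) (simp_all add: w_def f_diff f_scale uv bf_diff_left bf_scale_left)
    moreover have "w $ i = bf v e * f e"
      using ik by (simp add: w_def u_def v_def e_def axis_def)
    ultimately have "q dvd bf v e" using j by (simp add: prime_dvd_mult e_def)
    then have "q dvd v $ k" using uv by (intro rad)
    then show False using j ik by (simp add: v_def e_def axis_def)
  qed
  then show ?thesis using that by blast
qed

text \<open>Write \<open>s *s z = t *s y + q *s w\<close>. Comparing \<open>qf\<close> of both sides
  shows that \<open>q\<close> divides \<open>bf y w\<close>, which lifts divisibility of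
  \<open>s * bf y z\<close> from \<open>q\<close> to \<open>q^2\<close>.\<close>

lemma proportional_imp_dvd:
  assumes y: "qf y = q\<^sup>2 * N" and z: "qf z = q\<^sup>2 * N"
    and st: "\<not> q dvd s" "\<not> q dvd t" and st_dvd: "\<And>i. q dvd s * z $ i - t * y $ i"
  shows "q\<^sup>2 dvd bf y z"
proof -
  have "q dvd (s *s z - t *s y) $ i" for i using st_dvd by simp
  then obtain w where "s *s z - t *s y = q *s w" using int_vec_dvd by blast
  then have sz: "s *s z = t *s y + q *s w" by (simp add: algebra_simps)
  have "s\<^sup>2 * (q\<^sup>2 * N) = t\<^sup>2 * (q\<^sup>2 * N) + q * (t * bf y w) + q\<^sup>2 * qf w"
    using arg_cong[OF sz, of qf] by (simp add: qf_scale qf_add y z bf_scale bf_scale_left)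
  then have "q * (t * bf y w) = q * (q * (s\<^sup>2 * N - t\<^sup>2 * N - qf w))"
    by (simp add: algebra_simps power2_eq_square)
  then have "t * bf y w = q * (s\<^sup>2 * N - t\<^sup>2 * N - qf w)"
    using q_gt_1 by (simp only: mult_cancel_left) auto
  then have "q dvd t * bf y w" by simp
  then have "q dvd bf y w" using st by (simp add: prime_dvd_mult)
  then obtain r where r: "bf y w = q * r" by (elim dvdE)
  have "s * bf y z = bf y (s *s z)" by (simp add: bf_scale)
  also have "\<dots> = q\<^sup>2 * (2 * t * N + r)"
    unfolding sz by (simp add: bf_add bf_scale bf_self y r algebra_simps power2_eq_square)
  finally have "q\<^sup>2 dvd s * bf y z" by simp
  moreover have "coprime (q\<^sup>2) s"
    using prime_imp_coprime[OF prime_q st(1)] by simp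
  ultimately show ?thesis by (simp add: coprime_dvd_mult_right_iff)
qed

lemma eq_mod_range: "q dvd a - b \<Longrightarrow> a \<in> {0..<q} \<Longrightarrow> b \<in> {0..<q} \<Longrightarrow> a = b"
  using mod_eq_dvd_iff[of a q b] by auto

text \<open>
  Vectors divisible by \<open>q\<close> are harmless. For the others, with \<open>f h = 0\<close>, \<open>q\<close> not dividing \<open>qf h\<close> and
  \<open>e\<close> the \<open>j\<close>-th unit vector, the map \<open>(x, t, l, k) \<mapsto> t x + l h + k e mod q\<close> takes each of its at
  most \<open>q ^ 4\<close> values at most \<open>2 C\<close> times: \<open>f\<close> determines \<open>k\<close>, isotropy of \<open>t x\<close> is a quadratic
  equation for \<open>l\<close> with leading coefficient \<open>qf h\<close>, and once \<open>k\<close> and \<open>l\<close> are known all \<open>x\<close> are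
  proportional modulo \<open>q\<close>.
\<close>
lemma card_kernel_sphere:
  fixes C :: nat
  assumes f_add: "\<And>x y. f (x + y) = f x + f y" and f_scale: "\<And>c x. f (c *s x) = c * f x"
    and j: "\<not> q dvd f (axis j 1)"
    and small: "\<And>Y. (\<And>y. y \<in> Y \<Longrightarrow> qf y = q\<^sup>2 * N) \<Longrightarrow> (\<And>y z. y \<in> Y \<Longrightarrow> z \<in> Y \<Longrightarrow> q\<^sup>2 dvd bf y z)
      \<Longrightarrow> finite Y \<and> card Y \<le> C"
    and V: "\<And>x. x \<in> V \<Longrightarrow> qf x = q\<^sup>2 * N" "\<And>x. x \<in> V \<Longrightarrow> f x = 0"
  shows "(q - 1) * int (card V) \<le> int C * (2 * q\<^sup>2 + (q - 1))"
proof -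
  obtain h where h: "f h = 0" "\<not> q dvd qf h"
    using kernel_not_isotropic[OF f_add f_scale j] by blast
  define e :: "int ^ 4" where "e = axis j 1"
  define V0 where "V0 = {x \<in> V. \<forall>i. q dvd x $ i}"
  define V1 where "V1 = V - V0"
  have "finite V0 \<and> card V0 \<le> C"
  proof (rule small)
    fix y z assume "y \<in> V0" "z \<in> V0"
    then have dvd: "\<And>i. q dvd y $ i" "\<And>i. q dvd z $ i" by (auto simp: V0_def)
    obtain u where "y = q *s u" using int_vec_dvd[OF dvd(1)] .
    moreover obtain v where "z = q *s v" using int_vec_dvd[OF dvd(2)] .
    ultimately show "q\<^sup>2 dvd bf y z" by (simp add: bf_scale bf_scale_left power2_eq_square)
  qed (use V in \<open>auto simp: V0_def\<close>)
  define D where "D = V1 \<times> {1..<q} \<times> {0..<q} \<times> {0..<q}"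
  define \<Phi> where "\<Phi> = (\<lambda>(x, t, l, k). \<lambda>i. (t * x $ i + l * h $ i + k * e $ i) mod q)"
  have t_dvd: "\<not> q dvd t" if "t \<in> {1..<q}" for t
    using that zdvd_not_zless[of t q] by auto
  define E where "E = (UNIV \<rightarrow>\<^sub>E {0..<q} :: (4 \<Rightarrow> int) set)"
  have "finite D \<and> card D \<le> card E * (2 * C)"
  proof (rule card_le_fibres)
    show "finite E" by (simp add: E_def finite_PiE)
    show "\<Phi> ` D \<subseteq> E" using q_gt_1 by (auto simp: \<Phi>_def E_def)
    fix y
    define F where "F = {p \<in> D. \<Phi> p = y}"
    have F: "\<exists>w. t *s x = t' *s x' + (l' - l) *s h + q *s w"
      if p: "(x, t, l, k) \<in> F" "(x', t', l', k') \<in> F" for x t l k x' t' l' k'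
    proof -
      let ?v = "(t *s x + l *s h + k *s e) - (t' *s x' + l' *s h + k' *s e)"
      have "q dvd ?v $ i" for i
      proof -
        have "\<Phi> (x, t, l, k) i = \<Phi> (x', t', l', k') i" using p by (simp add: F_def)
        then show ?thesis by (simp add: \<Phi>_def mod_eq_dvd_iff)
      qed
      then obtain w where w: "?v = q *s w" using int_vec_dvd by blast
      have x: "f x = 0" "f x' = 0" using p V(2) by (auto simp: F_def D_def V1_def)
      have f_diff: "f (x - y) = f x - f y" for x y using f_add[of "x - y" y] by simp
      \<comment> \<open>Applying \<open>f\<close> annihilates \<open>x\<close>, \<open>x'\<close>
        and \<open>h\<close>, leaving only the \<open>e\<close> component.\<close>
      have "(k - k') * f e = q * f w"
        using arg_cong[OF w, of f] by (simp add: f_add f_scale f_diff h x algebra_simps)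
      then have "q dvd (k - k') * f e" by simp
      then have "q dvd k - k'" using j by (simp add: prime_dvd_mult e_def)
      then have "k = k'" using p by (intro eq_mod_range) (auto simp: F_def D_def)
      then have "t *s x = t' *s x' + (l' - l) *s h + q *s w"
        using w by (simp add: vec_eq_iff algebra_simps)
      then show ?thesis by blast
    qed
    have quad: "l = l' \<or> q dvd t' * bf x' h + (l' - l) * qf h"
      if p: "(x, t, l, k) \<in> F" "(x', t', l', k') \<in> F" for x t l k x' t' l' k'
    proof -
      obtain w where w: "t *s x = t' *s x' + (l' - l) *s h + q *s w" using F[OF p] by blast
      define u where "u = t' *s x' + (l' - l) *s h"
      have q0: "qf x = q\<^sup>2 * N" "qf x' = q\<^sup>2 * N" using p V(1) by (auto simp: F_def D_def V1_def)
      have "qf (t *s x) = qf u + q * bf u w + q\<^sup>2 * qf w"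
        unfolding w u_def[symmetric] by (simp add: qf_add qf_scale bf_scale)
      moreover have "qf u = t'\<^sup>2 * (q\<^sup>2 * N) + (l' - l) * (t' * bf x' h + (l' - l) * qf h)"
        unfolding u_def qf_add qf_scale bf_scale bf_scale_left q0
        by (simp add: algebra_simps power2_eq_square)
      ultimately have "(l' - l) * (t' * bf x' h + (l' - l) * qf h)
          = q * (t\<^sup>2 * q * N - t'\<^sup>2 * q * N - bf u w - q * qf w)"
        by (simp add: qf_scale q0 algebra_simps power2_eq_square)
      then have "q dvd (l' - l) * (t' * bf x' h + (l' - l) * qf h)" by simp
      then have "q dvd l' - l \<or> q dvd t' * bf x' h + (l' - l) * qf h" by (simp add: prime_dvd_mult)
      moreover have "l = l'" if "q dvd l' - l"
        using p eq_mod_range[OF that] by (auto simp: F_def D_def)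
      ultimately show ?thesis by blast
    qed
    define \<pi> where "\<pi> = (\<lambda>(x :: int ^ 4, t :: int, l :: int, k :: int). l)"
    have \<pi>_image: "\<exists>x t k. (x, t, l, k) \<in> F" if "l \<in> \<pi> ` F" for l
      using that by (force simp: \<pi>_def)
    \<comment> \<open>Relative to a fixed \<open>l'\<close>, every other \<open>l\<close> solves one
      linear congruence whose leading coefficient \<open>qf h\<close> is invertible modulo
      \<open>q\<close>, so there is at most one.\<close>
    have "card (\<pi> ` F) \<le> 2 \<and> finite (\<pi> ` F)"
    proof (cases "F = {}")
      case False
      then obtain x' t' l' k' where p': "(x', t', l', k') \<in> F" by auto
      have "l = m" if lm: "l \<in> \<pi> ` F - {l'}" "m \<in> \<pi> ` F - {l'}" for l m
      proof -
        obtain x t k where p1: "(x, t, l, k) \<in> F" using \<pi>_image[of l] lm by auto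
        obtain x2 t2 k2 where p2: "(x2, t2, m, k2) \<in> F" using \<pi>_image[of m] lm by auto
        note p = p1 p2
        have "q dvd t' * bf x' h + (l' - l) * qf h" "q dvd t' * bf x' h + (l' - m) * qf h"
          using quad[OF p(1) p'] quad[OF p(2) p'] lm by auto
        from dvd_diff[OF this(2) this(1)] have "q dvd (l - m) * qf h" by (simp add: algebra_simps)
        then have "q dvd l - m" using h by (simp add: prime_dvd_mult)
        then show ?thesis using p by (intro eq_mod_range) (auto simp: F_def D_def)
      qed
      then obtain l where "\<pi> ` F \<subseteq> {l', l}" by (cases "\<pi> ` F - {l'} = {}") blast+
      moreover have "card {l', l} \<le> 2" by (simp add: card_insert_if)
      ultimately show ?thesis by (meson card_mono finite.emptyI finite_insert finite_subset le_trans)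
    qed simp
    then have "card (\<pi> ` F) \<le> 2" "finite (\<pi> ` F)" by auto
    have "finite F \<and> card F \<le> card (\<pi> ` F) * C"
    proof (rule card_le_fibres)
      fix l
      define G where "G = {p \<in> F. \<pi> p = l}"
      have G: "q dvd t * x $ i - t' * x' $ i" if "(x, t, l, k) \<in> G" "(x', t', l', k') \<in> G"
        for x t l k x' t' l' k' i
      proof -
        have "l = l'" "(x, t, l, k) \<in> F" "(x', t', l', k') \<in> F"
          using that by (auto simp: G_def \<pi>_def)
        then obtain w where "t *s x = t' *s x' + (l' - l) *s h + q *s w"
          using F by blast
        with \<open>l = l'\<close> have "t *s x = t' *s x' + q *s w" by simp
        then have "t * x $ i = t' * x' $ i + q * w $ i"
          by (simp add: vec_eq_iff)
        then show ?thesis by simp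
      qed
      \<comment> \<open>With \<open>l\<close> fixed, first components are proportional modulo
        \<open>q\<close> by units, so their pairings are divisible by \<open>q^2\<close> and
        \<open>small\<close> applies.\<close>
      have "finite (fst ` G) \<and> card (fst ` G) \<le> C"
      proof (rule small)
        show "qf x = q\<^sup>2 * N" if "x \<in> fst ` G" for x
          using that V(1) by (auto simp: G_def F_def D_def V1_def)
        fix y z assume "y \<in> fst ` G" "z \<in> fst ` G"
        then obtain t l k t' l' k' where p: "(z, t, l, k) \<in> G" "(y, t', l', k') \<in> G" by auto
        show "q\<^sup>2 dvd bf y z"
        proof (rule proportional_imp_dvd)
          show "qf y = q\<^sup>2 * N" "qf z = q\<^sup>2 * N" "\<not> q dvd t" "\<not> q dvd t'"
            using p V(1) by (auto simp: G_def F_def D_def V1_def intro!: t_dvd)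
        qed (rule G[OF p])
      qed
      \<comment> \<open>Some coordinate of \<open>x\<close> is prime to \<open>q\<close>, which
        fixes \<open>t\<close>; coordinate \<open>j\<close>, where \<open>e\<close> is 1, then fixes
        \<open>k\<close>.\<close>
      moreover have "inj_on fst G"
      proof (rule inj_onI)
        fix p p' assume pp: "p \<in> G" "p' \<in> G" "fst p = fst p'"
        obtain x t l k where px: "p = (x, t, l, k)" by (cases p)
        obtain x' t' l' k' where px': "p' = (x', t', l', k')" by (cases p')
        have p: "(x, t, l, k) \<in> G" "(x', t', l', k') \<in> G" and "x = x'"
          using pp unfolding px px' by simp_all
        then have [simp]: "x' = x" "l' = l" by (auto simp: G_def \<pi>_def)
        have "\<exists>i. \<not> q dvd x $ i" using p by (auto simp: G_def F_def D_def V1_def V0_def)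
        then obtain i where i: "\<not> q dvd x $ i" by blast
        have "q dvd (t - t') * x $ i" using G[OF p, of i] by (simp add: algebra_simps)
        then have "q dvd t - t'" using i by (simp add: prime_dvd_mult)
        then have [simp]: "t' = t"
          using p eq_mod_range[of t t'] by (auto simp: G_def F_def D_def)
        have "\<Phi> (x, t, l, k) j = \<Phi> (x, t, l, k') j" using p by (simp add: G_def F_def)
        then have "q dvd k - k'" by (simp add: \<Phi>_def e_def mod_eq_dvd_iff)
        then have "k = k'" using p by (intro eq_mod_range) (auto simp: G_def F_def D_def)
        then show "p = p'" unfolding px px' by simp
      qed
      ultimately have "finite G \<and> card G \<le> C" by (simp add: card_image finite_image_iff)
      then show "finite {p \<in> F. \<pi> p = l} \<and> card {p \<in> F. \<pi> p = l} \<le> C" by (simp add: G_def)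
    qed (use \<open>finite (\<pi> ` F)\<close> in auto)
    moreover have "card (\<pi> ` F) * C \<le> 2 * C" using \<open>card (\<pi> ` F) \<le> 2\<close> by simp
    ultimately show "finite {p \<in> D. \<Phi> p = y} \<and> card {p \<in> D. \<Phi> p = y} \<le> 2 * C"
      unfolding F_def by linarith
  qed
  moreover have "card E = nat q ^ 4" by (simp add: E_def card_PiE)
  moreover have "card D = card V1 * (nat (q - 1) * (nat q * nat q))"
    by (simp add: D_def card_cartesian_product)
  \<comment> \<open>Double counting: each point of \<open>V1\<close> contributes
    \<open>(q - 1) * q^2\<close> elements of \<open>D\<close>, against \<open>q ^ 4\<close> values;
    a factor \<open>q^2\<close> cancels below.\<close>
  ultimately have "card V1 * (nat (q - 1) * (nat q * nat q)) \<le> nat q ^ 4 * (2 * C)"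
    by metis
  then have "int (card V1 * (nat (q - 1) * (nat q * nat q))) \<le> int (nat q ^ 4 * (2 * C))"
    by (simp only: of_nat_le_iff)
  then have "q\<^sup>2 * ((q - 1) * int (card V1)) \<le> q\<^sup>2 * (2 * int C * q\<^sup>2)"
    using q_gt_1 by (simp add: mult_ac power2_eq_square power4_eq_xxxx)
  then have V1: "(q - 1) * int (card V1) \<le> 2 * int C * q\<^sup>2"
    using q_gt_1 by (simp only: mult_le_cancel_left) simp
  \<comment> \<open>Restoring the at most \<open>C\<close> vectors divisible by \<open>q\<close>
    accounts for the summand \<open>q - 1\<close> of the bound.\<close>
  have "V = V1 \<union> V0" by (auto simp: V1_def V0_def)
  then have "card V \<le> card V1 + card V0" using card_Un_le by metis
  then have "int (card V) \<le> int (card V1) + int C" using \<open>finite V0 \<and> card V0 \<le> C\<close> by linarith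
  then have "(q - 1) * int (card V) \<le> (q - 1) * (int (card V1) + int C)"
    using q_gt_1 by (intro mult_left_mono) auto
  then show ?thesis using V1 by (simp add: algebra_simps)
qed

end

section \<open>Vectors on a sphere\<close>

text \<open>Multiply by a common denominator and divide by the gcd. This turns a nonzero rational
  functional into an integral one that stays nonzero modulo \<open>q\<close>.\<close>

lemma clear_denominators:
  fixes a :: "4 \<Rightarrow> rat" and q :: int
  assumes "a l \<noteq> 0" "prime q"
  obtains t z j where "\<And>i. t * a i = of_int (z i)" "\<not> q dvd z j"
proof -
  have "\<exists>n e. a i = of_int n / of_int e \<and> e > 0" for i
    using quotient_of_div[of "a i", OF prod.collapse[symmetric]] quotient_of_denom_pos'[of "a i"]
    by blast
  then obtain n e where ne: "\<And>i. a i = of_int (n i) / of_int (e i)" "\<And>i. e i > 0"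
    by metis
  define D where "D = (\<Prod>i\<in>UNIV. e i)"
  have "D > 0" unfolding D_def using ne(2) by (intro prod_pos) auto
  have "\<exists>y. of_int D * a i = of_int y" for i
  proof -
    have "e i dvd D" unfolding D_def by (rule dvd_prodI) auto
    then obtain r where "D = e i * r" by (elim dvdE)
    then have "of_int D * a i = of_int (r * n i)"
      using ne(2)[of i] by (simp add: ne(1))
    then show ?thesis by blast
  qed
  then obtain y where y: "\<And>i. of_int D * a i = of_int (y i)" by metis
  define G where "G = Gcd (range y)"
  have "y l \<noteq> 0" using y[of l] assms(1) \<open>D > 0\<close> by auto
  then have "G \<noteq> 0" by (auto simp: G_def)
  have G_dvd: "G dvd y i" for i by (simp add: G_def)
  \<comment> \<open>If \<open>q\<close> divided every quotient, \<open>q * G\<close> would divide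
    the gcd \<open>G\<close>.\<close>
  have "\<exists>j. \<not> q dvd y j div G"
  proof (rule ccontr)
    assume "\<not> ?thesis"
    then have "q * G dvd y j" for j
      using G_dvd[of j] mult_dvd_mono[of q "y j div G" G G] by simp
    then have "q * G dvd G" unfolding G_def by (intro Gcd_greatest) auto
    then have "q dvd 1" using \<open>G \<noteq> 0\<close> dvd_times_right_cancel_iff[of G q 1] by simp
    then show False using assms(2) not_prime_unit by blast
  qed
  then obtain j where "\<not> q dvd y j div G" by blast
  moreover have "of_int D / of_int G * a i = of_int (y i div G)" for i
  proof -
    obtain r where r: "y i = G * r" using G_dvd[of i] by (elim dvdE)
    then have "of_int D * a i = of_int G * of_int r" using y[of i] by simp
    then show ?thesis using r \<open>G \<noteq> 0\<close> by simp
  qed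
  ultimately show ?thesis
    using that[of "of_int D / of_int G" "\<lambda>i. y i div G" j] by blast
qed

lemma independent_card_le_4:
  fixes S :: "(rat ^ 4) set"
  assumes "vec.independent S"
  shows "finite S \<and> card S \<le> 4"
  using vec.independent_bound_general[OF assms] vec.dim_subset_UNIV[of S]
  by (simp add: vec.dimension_def card_cart_basis)

context quat_lattice
begin

text \<open>A maximal independent subset of \<open>Y\<close> has at most four elements, and the
  products with them determine a vector of \<open>Y\<close>: the difference of two vectors with
  equal products lies in their span and is orthogonal to it.\<close>

lemma card_pairwise_values:
  assumes "finite T" "card T \<le> n" "n > 0" "\<And>y z. y \<in> Y \<Longrightarrow> z \<in> Y \<Longrightarrow> 2 * B y z \<in> T"
  shows "finite Y \<and> card Y \<le> n ^ 4"
proof -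
  obtain S where S: "S \<subseteq> Y" "vec.independent S" "Y \<subseteq> vec.span S"
    by (rule vec.maximal_independent_subset)
  have fS: "finite S" "card S \<le> 4"
    using independent_card_le_4[OF S(2)] by auto
  define g where "g y = restrict (\<lambda>s. 2 * B y s) S" for y
  have inj: "inj_on g Y"
  proof (rule inj_onI)
    fix y z assume yz: "y \<in> Y" "z \<in> Y" "g y = g z"
    have S0: "B (y - z) s = 0" if "s \<in> S" for s
      using fun_cong[OF yz(3), of s] that by (simp add: g_def B_diff_left)
    have "B (y - z) x = 0" if "x \<in> vec.span S" for x
      using that
      by (induction rule: vec.span_induct_alt) (simp_all add: B_add_right B_scale_right S0)
    moreover have "y - z \<in> vec.span S" using yz S(3) by (intro vec.span_diff) auto
    ultimately have "Q (y - z) = 0" by (simp add: Q_def)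
    then show "y = z" by (simp add: Q_eq_0)
  qed
  have img: "g ` Y \<subseteq> S \<rightarrow>\<^sub>E T" using assms(4) S(1) by (auto simp: g_def)
  have fin: "finite (S \<rightarrow>\<^sub>E T)" using fS assms(1) by (intro finite_PiE) auto
  have "card Y \<le> card (S \<rightarrow>\<^sub>E T)" using inj img fin by (rule card_inj_on_le)
  also have "\<dots> = card T ^ card S" using fS by (simp add: card_PiE)
  also have "\<dots> \<le> n ^ card S" using assms(2) by (rule power_mono) simp
  also have "\<dots> \<le> n ^ 4" using fS(2) assms(3) by (intro power_increasing) auto
  finally show ?thesis using inj_on_finite[OF inj img fin] by simp
qed

text \<open>If \<open>V\<close> did not span, it would lie in the kernel of a functional, and
  \<open>card_kernel_sphere\<close> in lattice coordinates would contradict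
  \<open>big\<close>.\<close>

lemma sphere_spans:
  fixes q N :: nat
  defines "V \<equiv> {x \<in> P. Q x = of_nat (q\<^sup>2 * N)}"
  assumes q: "prime q" "\<not> int q dvd d"
    and big: "int ((4 * N + 1) ^ 4) * (2 * (int q)\<^sup>2 + (int q - 1)) < (int q - 1) * int (card V)"
  obtains v where "frame v" "\<And>i. v i \<in> V"
proof -
  obtain S where S: "S \<subseteq> V" "vec.independent S" "V \<subseteq> vec.span S"
    by (rule vec.maximal_independent_subset)
  have fS: "finite S" "card S \<le> 4"
    using independent_card_le_4[OF S(2)] by auto
  have "card S = 4"
  proof (rule ccontr)
    assume "card S \<noteq> 4"
    then have "card S < 4" using fS by simp
    have "vec.span S \<noteq> UNIV"
    proof
      assume "vec.span S = UNIV"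
      then have "vec.dim S = 4" using vec.dim_span[of S] by (simp add: card_cart_basis)
      then show False using \<open>card S < 4\<close> S(2) by (simp add: vec.dim_eq_card_independent)
    qed
    \<comment> \<open>To get a functional vanishing on \<open>S\<close>, extend linearly from
      \<open>e\<close> to \<open>e\<close> and from \<open>S\<close> to 0, then read off a
      coordinate where \<open>e\<close> is nonzero.\<close>
    then obtain e where e: "e \<notin> vec.span S" by auto
    then have "vec.independent (insert e S)" using S(2) by (simp add: vec.independent_insertI)
    then obtain g :: "rat ^ 4 \<Rightarrow> rat ^ 4" where g: "Vector_Spaces.linear (*s) (*s) g"
      and gS: "\<forall>x\<in>insert e S. g x = (if x = e then e else 0)"
      using vec.linear_independent_extend[of "insert e S" "\<lambda>x. if x = e then e else 0"] by blast
    have g_add: "g (x + y) = g x + g y" and g_scale: "g (r *s x) = r *s g x" for x y r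
      using g by (auto simp: Vector_Spaces.linear_iff)
    have "e \<noteq> 0" using e vec.span_zero by metis
    then obtain i0 where i0: "e $ i0 \<noteq> 0" by (auto simp: vec_eq_iff)
    define \<phi> where "\<phi> x = g x $ i0" for x
    have \<phi>_add: "\<phi> (x + y) = \<phi> x + \<phi> y" and \<phi>_scale: "\<phi> (r *s x) = r * \<phi> x" for x y r
      by (simp_all add: \<phi>_def g_add g_scale)
    have \<phi>_zero: "\<phi> 0 = 0" using \<phi>_scale[of 0 0] by simp
    have \<phi>_S: "\<phi> x = 0" if "x \<in> vec.span S" for x
      using that
    proof (induction rule: vec.span_induct_alt)
      case (step c x y)
      have "x \<noteq> e" using step(1) e vec.span_base by metis
      then have "\<phi> x = 0" using gS step(1) by (simp add: \<phi>_def)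
      then show ?case using step by (simp add: \<phi>_add \<phi>_scale)
    qed (rule \<phi>_zero)
    obtain b where b: "lattice_basis L b" by (rule basis_ex)
    have fb: "frame b" using b by (rule lattice_basis_frame)
    have \<phi>_sum: "\<phi> (\<Sum>i\<in>I. h i) = (\<Sum>i\<in>I. \<phi> (h i))" for I :: "4 set" and h
      by (induction I rule: infinite_finite_induct) (simp_all add: \<phi>_add \<phi>_zero)
    have \<phi>_cmb: "\<phi> (cmb b c) = (\<Sum>i\<in>UNIV. c i * \<phi> (b i))" for c
      by (simp add: cmb_def \<phi>_sum \<phi>_scale)
    obtain l where l: "\<phi> (b l) \<noteq> 0"
    proof -
      obtain c where "e = cmb b c" using frame_cmb_ex[OF fb] .
      moreover have "\<phi> e \<noteq> 0" using gS i0 by (simp add: \<phi>_def)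
      ultimately have "(\<Sum>i\<in>UNIV. c i * \<phi> (b i)) \<noteq> 0" using \<phi>_cmb[of c] by simp
      then have "\<exists>i. c i * \<phi> (b i) \<noteq> 0" by (meson sum.neutral)
      then show ?thesis using that by auto
    qed
    have pq: "prime (int q)" using q by simp
    \<comment> \<open>Rescaled, the functional is integral on the lattice and nonzero modulo
      \<open>q\<close>.\<close>
    obtain t z j where z: "\<And>i. t * \<phi> (b i) = of_int (z i)" "\<not> int q dvd z j"
      by (rule clear_denominators[of "\<lambda>i. \<phi> (b i)", OF l pq]) blast
    define f where "f x = (\<Sum>i\<in>UNIV. x $ i * z i)" for x :: "int ^ 4"
    define pt where "pt x = cmb b (\<lambda>i. of_int (x $ i))" for x :: "int ^ 4"
    have pt_P: "pt x \<in> P" for x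
      unfolding pt_def using lattice_basis_in_P[OF b] by (intro P_cmb)
    have pt_add: "pt (x + y) = pt x + pt y" and pt_scale: "pt (k *s x) = of_int k *s pt x" for x y k
      by (simp_all add: pt_def flip: cmb_add cmb_scale)
    have pt_axis: "pt (axis i 1) = b i" for i
    proof -
      have "(\<lambda>k. of_int (axis i 1 $ k)) = (\<lambda>k. if k = i then 1 else 0 :: rat)"
        by (auto simp: axis_def)
      then show ?thesis by (simp add: pt_def cmb_unit)
    qed
    have inj_pt: "inj pt"
    proof (rule injI)
      fix x y assume "pt x = pt y"
      then have "(\<lambda>i. of_int (x $ i)) = (\<lambda>i. of_int (y $ i) :: rat)"
        unfolding pt_def by (rule frame_cmb_inj[OF fb])
      then show "x = y" by (simp add: vec_eq_iff fun_eq_iff)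
    qed
    have pt_surj: "\<exists>k. x = pt k" if x: "x \<in> P" for x
    proof -
      obtain k where "x = cmb b (\<lambda>i. of_int (k i))" using x lattice_basis_points[OF b] by blast
      then show ?thesis by (intro exI[of _ "\<chi> i. k i"]) (simp add: pt_def)
    qed
    \<comment> \<open>\<open>Q\<close> and \<open>2B\<close> are integral on the lattice, so the
      floors are exact.\<close>
    define qi where "qi x = \<lfloor>Q (pt x)\<rfloor>" for x
    define bi where "bi x y = \<lfloor>2 * B (pt x) (pt y)\<rfloor>" for x y
    have qi: "of_int (qi x) = Q (pt x)" for x
      unfolding qi_def using Q_Ints[OF pt_P] by (auto elim: Ints_cases)
    have bi: "of_int (bi x y) = 2 * B (pt x) (pt y)" for x y
      unfolding bi_def using B_Ints[OF pt_P pt_P] by (auto elim!: Ints_cases)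
    interpret integral_form qi bi
    proof
      fix x y z c
      have "(of_int (bi x (y + z)) :: rat) = of_int (bi x y + bi x z)"
        by (simp add: bi pt_add B_simps)
      then show "bi x (y + z) = bi x y + bi x z" by (simp only: of_int_eq_iff)
      have "(of_int (bi x (c *s y)) :: rat) = of_int (c * bi x y)"
        by (simp add: bi pt_scale B_simps)
      then show "bi x (c *s y) = c * bi x y" by (simp only: of_int_eq_iff)
      show "bi x y = bi y x" by (simp add: bi_def B_sym)
      have "(of_int (qi (x + y)) :: rat) = of_int (qi x + bi x y + qi y)"
        by (simp add: bi qi pt_add Q_add)
      then show "qi (x + y) = qi x + bi x y + qi y" by (simp only: of_int_eq_iff)
      have "(of_int (qi (c *s x)) :: rat) = of_int (c\<^sup>2 * qi x)"
        by (simp add: qi pt_scale Q_scale)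
      then show "qi (c *s x) = c\<^sup>2 * qi x" by (simp only: of_int_eq_iff)
    qed
    interpret integral_form_mod qi bi "int q"
    proof
      \<comment> \<open>The vector \<open>u / q\<close> pairs integrally with the basis under
        \<open>2B\<close>. By Cramer's rule \<open>u $ i * d / q\<close> is an integer, and
        \<open>q\<close> does not divide \<open>d\<close>.\<close>
      fix u i assume u: "\<And>y. int q dvd bi u y"
      let ?c = "\<lambda>i. inverse (of_nat q) * of_int (u $ i)"
      have "?c i * det (gram b) \<in> \<int>"
      proof (rule gram_cramer)
        show "2 * B (b i) (b j) \<in> \<int>" for i j by (simp add: B_Ints lattice_basis_in_P[OF b])
        fix i
        obtain r where "bi u (axis i 1) = int q * r" using u[of "axis i 1"] by (elim dvdE)
        then have "2 * B (pt u) (b i) = of_nat q * of_int r"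
          using bi[of u "axis i 1"] by (simp add: pt_axis)
        then have "2 * B (b i) (cmb b ?c) = of_int r"
          using q prime_gt_0_nat[of q]
          by (simp add: cmb_scale B_simps B_sym[of "b i"] flip: pt_def) (simp add: field_simps)
        then show "2 * B (b i) (cmb b ?c) \<in> \<int>" by simp
      qed
      then obtain r where "?c i * det (gram b) = of_int r" by (auto elim: Ints_cases)
      then have "(of_int (u $ i * d) :: rat) = of_int (int q * r)"
        using q prime_gt_0_nat[of q] by (simp add: field_simps flip: disc_det[OF b])
      then have "u $ i * d = int q * r" by (simp only: of_int_eq_iff)
      then have "int q dvd u $ i * d" by simp
      then show "int q dvd u $ i" using pq q(2) by (simp add: prime_dvd_mult_iff)
    qed (rule pq)
    define V' where "V' = {x. pt x \<in> V}"
    have "pt ` V' = V" using pt_surj by (auto simp: V'_def V_def)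
    then have "card V' = card V" 
      using card_image[OF inj_on_subset[OF inj_pt subset_UNIV], of V'] by simp
    have qi_eq: "qi x = (int q)\<^sup>2 * int N \<longleftrightarrow> Q (pt x) = of_nat (q\<^sup>2 * N)" for x
    proof -
      have "qi x = (int q)\<^sup>2 * int N \<longleftrightarrow> (of_int (qi x) :: rat) = of_int ((int q)\<^sup>2 * int N)"
        by (simp only: of_int_eq_iff)
      then show ?thesis by (simp add: qi)
    qed
    have "(int q - 1) * int (card V') \<le> int ((4 * N + 1) ^ 4) * (2 * (int q)\<^sup>2 + (int q - 1))"
    proof (rule card_kernel_sphere)
      show "f (x + y) = f x + f y" "f (c *s x) = c * f x" for x y c
        by (simp_all add: f_def algebra_simps sum.distrib sum_distrib_left)
      have "f (axis j 1) = (\<Sum>i\<in>UNIV. if i = j then z i else 0)"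
        unfolding f_def by (rule sum.cong) (auto simp: axis_def)
      then show "\<not> int q dvd f (axis j 1)" using z(2) by simp
      show "qi x = (int q)\<^sup>2 * int N" if "x \<in> V'" for x
        using that by (simp add: qi_eq V'_def V_def)
      show "f x = 0" if "x \<in> V'" for x
      proof -
        have "\<phi> (pt x) = 0" using that S(3) \<phi>_S by (auto simp: V'_def)
        moreover have "t * \<phi> (pt x) = of_int (f x)"
          unfolding pt_def \<phi>_cmb f_def by (simp add: sum_distrib_left mult.left_commute[of t] z)
        ultimately show ?thesis by simp
      qed
      fix Y assume Y: "\<And>y. y \<in> Y \<Longrightarrow> qi y = (int q)\<^sup>2 * int N"
        "\<And>y z. y \<in> Y \<Longrightarrow> z \<in> Y \<Longrightarrow> (int q)\<^sup>2 dvd bi y z"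
      \<comment> \<open>On this sphere \<open>2B\<close> is at most \<open>2 * q^2 * N\<close> in
        absolute value, leaving \<open>4 * N + 1\<close> multiples of \<open>q^2\<close>: a count
        independent of \<open>q\<close>.\<close>
      let ?T = "(\<lambda>k. of_int ((int q)\<^sup>2 * k)) ` {- 2 * int N..2 * int N} :: rat set"
      have "card ?T \<le> card {- 2 * int N..2 * int N}" by (rule card_image_le) simp
      then have T: "card ?T \<le> 4 * N + 1" by simp
      have "finite (pt ` Y) \<and> card (pt ` Y) \<le> (4 * N + 1) ^ 4"
      proof (rule card_pairwise_values[OF _ T])
        fix y z assume "y \<in> pt ` Y" "z \<in> pt ` Y"
        then obtain x w where xw: "x \<in> Y" "w \<in> Y" "y = pt x" "z = pt w" by blast
        obtain k where k: "bi x w = (int q)\<^sup>2 * k" using Y(2)[OF xw(1,2)] by (elim dvdE)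
        have "(of_int \<bar>bi x w\<bar> :: rat) \<le> of_int (qi x + qi w)"
          using B_bound[of y z] by (simp add: bi qi xw)
        then have "\<bar>(int q)\<^sup>2 * k\<bar> \<le> (int q)\<^sup>2 * (2 * int N)"
          unfolding of_int_le_iff k Y(1)[OF xw(1)] Y(1)[OF xw(2)] by (simp add: mult.commute)
        then have "\<bar>k\<bar> \<le> 2 * int N"
          using q prime_gt_0_nat[of q] by (simp add: abs_mult)
        then have "k \<in> {- 2 * int N..2 * int N}" by auto
        moreover have "2 * B y z = of_int ((int q)\<^sup>2 * k)"
          using bi[of x w] k xw by simp
        ultimately show "2 * B y z \<in> ?T" by (rule image_eqI[rotated])
      qed auto
      moreover have "inj_on pt Y" using inj_pt by (rule inj_on_subset) simp
      ultimately show "finite Y \<and> card Y \<le> (4 * N + 1) ^ 4"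
        by (simp add: finite_image_iff card_image)
    qed
    then show False using big \<open>card V' = card V\<close> by simp
  qed
  then obtain v :: "4 \<Rightarrow> rat ^ 4" where v: "bij_betw v UNIV S"
    using finite_same_card_bij[of "UNIV :: 4 set" S] fS by auto
  then have "frame v" using S(2) by (simp add: frame_def bij_betw_def)
  moreover have "v i \<in> V" for i using v S(1) by (auto simp: bij_betw_def)
  ultimately show ?thesis using that by blast
qed

end

section \<open>Bounded frames\<close>

lemma h_factor_one_ge:
  assumes "\<not> int p dvd d"
  shows "h_factor p d 1 \<ge> (int p)\<^sup>2 - int p + 1"
proof -
  \<comment> \<open>The minimum is attained when the symbol is -1.\<close>
  have "Legendre d (int p) = 1 \<or> Legendre d (int p) = - 1"
    using assms by (auto simp: Legendre_def cong_0_iff)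
  moreover have "h_factor p d 1 = 1 + Legendre d (int p) * int p + (Legendre d (int p))\<^sup>2 * (int p)\<^sup>2"
    by (simp add: h_factor_def numeral_2_eq_2)
  ultimately show ?thesis by auto
qed

text \<open>The equations for \<open>m\<close> and \<open>q * m\<close> share the factor
  \<open>m1\<close>, since \<open>q\<close> joins \<open>m2\<close>. Their products differ only by
  the local factor at \<open>q\<close>, so \<open>r(q^2 m^2) = r(m^2) * h_q(dL, 1)\<close>.\<close>

lemma rep_num_mult_prime:
  fixes m q :: nat
  assumes reg: "strongly_s_regular L" and m: "m > 0" "rep_num (m\<^sup>2) L \<noteq> 0"
    and q: "prime q" "\<not> int q dvd 2 * lattice_disc L" "\<not> q dvd m"
  shows "int (rep_num (q\<^sup>2 * m\<^sup>2) L) \<ge> (int q)\<^sup>2 - int q + 1"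
proof -
  let ?d = "lattice_disc L"
  let ?S = "\<lambda>n. {p. prime p \<and> p dvd n \<and> \<not> int p dvd 2 * ?d}"
  let ?h = "\<lambda>n p. h_factor p ?d (multiplicity p n)"
  obtain m1 m2 where m12: "m = m1 * m2" "\<forall>p. prime p \<and> p dvd m1 \<longrightarrow> int p dvd 2 * ?d"
    "coprime (int m2) (2 * ?d)"
    using split_coprime[OF m(1)] by metis
  have "coprime (int q) (2 * ?d)" using q by (intro prime_imp_coprime) auto
  then have cop: "coprime (int (q * m2)) (2 * ?d)" using m12(3) by simp
  have eq1: "int (rep_num (m\<^sup>2) L) = int (rep_num (m1\<^sup>2) L) * (\<Prod>p\<in>?S m. ?h m p)"
    using reg[unfolded strongly_s_regular_def, rule_format, of m m1 m2] m m12
    by (simp add: power_mult_distrib)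
  have eq2: "int (rep_num (m1\<^sup>2 * (q * m2)\<^sup>2) L)
      = int (rep_num (m1\<^sup>2) L) * (\<Prod>p\<in>?S (q * m). ?h (q * m) p)"
    using m12 q(1) prime_gt_0_nat[OF q(1)] m cop
    by (intro reg[unfolded strongly_s_regular_def, rule_format]) auto
  have "?S (q * m) = insert q (?S m)"
    using q(1,2) by (auto simp: prime_dvd_mult_iff dest: primes_dvd_imp_eq)
  moreover have "finite (?S m)"
    by (rule finite_subset[of _ "{..m}"]) (use m dvd_imp_le in auto)
  ultimately have "(\<Prod>p\<in>?S (q * m). ?h (q * m) p) = ?h (q * m) q * (\<Prod>p\<in>?S m. ?h (q * m) p)"
    using q(3) by simp
  also have "(\<Prod>p\<in>?S m. ?h (q * m) p) = (\<Prod>p\<in>?S m. ?h m p)"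
  proof (rule prod.cong[OF refl])
    fix p assume p: "p \<in> ?S m"
    then have "p \<noteq> q" using q(3) by auto
    then have "multiplicity p q = 0" using p q(1) by (intro prime_multiplicity_other) auto
    then have "multiplicity p (q * m) = multiplicity p m"
      using p q(1) m(1) by (subst prime_elem_multiplicity_mult_distrib) auto
    then show "?h (q * m) p = ?h m p" by simp
  qed
  also have "?h (q * m) q = h_factor q ?d 1"
    using q m(1) by (subst prime_elem_multiplicity_mult_distrib) (auto simp: not_dvd_imp_multiplicity_0)
  finally have "int (rep_num (m1\<^sup>2 * (q * m2)\<^sup>2) L) = int (rep_num (m\<^sup>2) L) * h_factor q ?d 1"
    using eq1 eq2 by simp
  moreover have "m1\<^sup>2 * (q * m2)\<^sup>2 = q\<^sup>2 * m\<^sup>2"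
    by (simp add: m12 power_mult_distrib)
  ultimately have eq: "int (rep_num (q\<^sup>2 * m\<^sup>2) L) = int (rep_num (m\<^sup>2) L) * h_factor q ?d 1" by simp
  have h: "h_factor q ?d 1 \<ge> (int q)\<^sup>2 - int q + 1" 
    using q(2) dvd_mult by (intro h_factor_one_ge) blast
  have "int q \<le> (int q)\<^sup>2" using prime_gt_0_nat[OF q(1)] by (simp add: power2_eq_square)
  then have "1 * h_factor q ?d 1 \<le> int (rep_num (m\<^sup>2) L) * h_factor q ?d 1"
    using m(2) h by (intro mult_right_mono) linarith+
  then show ?thesis using eq h by linarith
qed

text \<open>The left side is quadratic in \<open>q\<close>, the right side cubic, so
  \<open>q\<close> of the order of \<open>C\<close> suffices; the constant 12 is not sharp.\<close>

lemma cubic_bound: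
  fixes C q c :: int
  assumes "12 * C + 2 \<le> q" "C \<ge> 1" "q\<^sup>2 - q + 1 \<le> c"
  shows "C * (2 * q\<^sup>2 + (q - 1)) < (q - 1) * c"
proof -
  have q: "q \<ge> 3" using assms by linarith
  have "12 * C * (2 * q\<^sup>2 + (q - 1)) \<le> q * (2 * q\<^sup>2 + (q - 1))"
    using assms q by (intro mult_right_mono) auto
  moreover have "3 * 3 \<le> q * q" "3 * (q * q) \<le> q * (q * q)"
    using q by (intro mult_mono mult_right_mono; simp)+
  ultimately have "12 * (C * (2 * q\<^sup>2 + (q - 1))) < 12 * ((q - 1) * (q\<^sup>2 - q + 1))"
    unfolding power2_eq_square using q by (simp only: algebra_simps)
  also have "\<dots> \<le> 12 * ((q - 1) * c)"
    using assms q by (intro mult_left_mono) auto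
  finally show ?thesis by simp
qed

lemma regular_lattice_bounded_frame:
  fixes m :: nat
  assumes "m > 0"
  shows "\<exists>M :: nat. \<forall>L. quaternary_lattice L \<and> strongly_s_regular L \<and> min_square L = m \<longrightarrow>
    (\<exists>v. frame v \<and> (\<forall>i. v i \<in> points L \<and> qmap L (v i) \<le> of_nat M))"
proof -
  define N where "N = m\<^sup>2"
  define C where "C = (4 * N + 1) ^ 4"
  \<comment> \<open>\<open>12 * C + 2\<close> is what \<open>cubic_bound\<close> asks for; the
    summand \<open>m\<close> forces \<open>q > m\<close>, hence \<open>q\<close> does not divide
    \<open>m\<close>.\<close>
  define q0 where "q0 = 12 * C + 2 + m"
  \<comment> \<open>\<open>768 = 2 * 24 * 2 ^ 4\<close>: the bound of \<open>disc_le\<close> at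
    length \<open>q^2 * N\<close>, doubled because it is applied to
    \<open>D = 2 * \<bar>d\<bar>\<close>.\<close>
  obtain R where R: "\<And>D. D > 0 \<Longrightarrow>
      \<exists>q. prime q \<and> q \<ge> q0 \<and> \<not> q dvd D \<and> (D \<le> (768 * N ^ 4) * q ^ 8 \<longrightarrow> q \<le> R)"
    using small_prime_not_dvd[of q0 "768 * N ^ 4" 8] by blast
  have "\<exists>v. frame v \<and> (\<forall>i. v i \<in> points L \<and> qmap L (v i) \<le> of_nat (R\<^sup>2 * N))"
    if L: "quaternary_lattice L" "strongly_s_regular L" "min_square L = m" for L
  proof -
    interpret quat_lattice L by unfold_locales (rule L(1))
    \<comment> \<open>As \<open>m > 0\<close>, the default value 0 of \<open>min_square\<close> is
      excluded.\<close>
    have "\<exists>n>0. rep_num (n\<^sup>2) L \<noteq> 0" using L(3) assms by (auto simp: min_square_def split: if_splits)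
    moreover from this have "m = (LEAST n. n > 0 \<and> rep_num (n\<^sup>2) L \<noteq> 0)"
      using L(3) by (simp add: min_square_def)
    ultimately have rep: "rep_num (m\<^sup>2) L \<noteq> 0"
      using LeastI_ex[of "\<lambda>n. n > 0 \<and> rep_num (n\<^sup>2) L \<noteq> 0"] by simp
    define D where "D = nat (2 * \<bar>d\<bar>)"
    have "D > 0" using disc_nonzero by (simp add: D_def)
    then obtain q where q: "prime q" "q \<ge> q0" "\<not> q dvd D"
      and qR: "D \<le> (768 * N ^ 4) * q ^ 8 \<Longrightarrow> q \<le> R" using R by blast
    have "int D = \<bar>2 * d\<bar>" by (simp add: D_def)
    then have q2d: "\<not> int q dvd 2 * d" using q(3) by (metis dvd_abs_iff int_dvd_int_iff)
    have "q > m" using q(2) by (simp add: q0_def)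
    then have "\<not> q dvd m" using assms nat_dvd_not_less by blast
    let ?V = "{x \<in> P. Q x = of_nat (q\<^sup>2 * N)}"
    have "(int q)\<^sup>2 - int q + 1 \<le> int (card ?V)"
      using rep_num_mult_prime[OF L(2) assms rep q(1) q2d \<open>\<not> q dvd m\<close>]
      by (simp add: rep_num_def N_def)
    moreover have "12 * int C + 2 \<le> int q" using q(2) by (simp add: q0_def)
    moreover have "C > 0" by (simp add: C_def)
    ultimately have "int C * (2 * (int q)\<^sup>2 + (int q - 1)) < (int q - 1) * int (card ?V)"
      by (intro cubic_bound) auto
    then have big: "int ((4 * N + 1) ^ 4) * (2 * (int q)\<^sup>2 + (int q - 1)) < (int q - 1) * int (card ?V)"
      unfolding C_def .
    have "\<not> int q dvd d" using q2d by auto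
    then obtain v where v: "frame v" "\<And>i. v i \<in> ?V" using sphere_spans[OF q(1) _ big] by blast
    have "(of_int \<bar>d\<bar> :: rat) \<le> 24 * (2 * of_nat (q\<^sup>2 * N)) ^ 4"
      using v by (intro disc_le) auto
    also have "\<dots> = of_int (24 * (2 * int (q\<^sup>2 * N)) ^ 4)" by simp
    finally have "\<bar>d\<bar> \<le> 24 * (2 * int (q\<^sup>2 * N)) ^ 4" unfolding of_int_le_iff .
    also have "\<dots> = 384 * (int N ^ 4 * int q ^ 8)"
      by (simp add: power_mult_distrib flip: power_mult)
    finally have "int D \<le> int (768 * N ^ 4 * q ^ 8)" by (simp add: D_def)
    then have "q \<le> R" by (intro qR) (simp only: of_nat_le_iff)
    then have "q\<^sup>2 * N \<le> R\<^sup>2 * N" by simp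
    then have "(of_nat (q\<^sup>2 * N) :: rat) \<le> of_nat (R\<^sup>2 * N)" by (simp only: of_nat_le_iff)
    then show ?thesis using v by (intro exI[of _ v]) auto
  qed
  then show ?thesis by blast
qed

section \<open>Finitely many isometry classes with a bounded frame\<close>

text \<open>
  Every lattice point is an integral combination of the frame plus a point with coordinates in
  \<open>[0, 1)\<close>, so the two components determine the lattice up to isometry.
\<close>
definition frame_shape :: "zlattice \<Rightarrow> (4 \<Rightarrow> rat ^ 4) \<Rightarrow> (4 \<Rightarrow> 4 \<Rightarrow> rat) \<times> (4 \<Rightarrow> rat) set" where
  "frame_shape L v = ((\<lambda>i j. 2 * bform L (v i) (v j)),
     {c. (\<forall>i. 0 \<le> c i \<and> c i < 1) \<and> cmb v c \<in> points L})"

context quat_lattice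
begin

lemma B_cmb_cmb: "B (cmb v c) (cmb v e) = (\<Sum>j\<in>UNIV. \<Sum>i\<in>UNIV. e j * (c i * B (v j) (v i)))"
  by (simp add: B_cmb B_sym[of "cmb v c"] sum_distrib_left)

lemma cmb_frac_in_P:
  assumes "\<And>i. v i \<in> P"
  shows "cmb v (\<lambda>i. frac (c i)) \<in> P \<longleftrightarrow> cmb v c \<in> P"
proof -
  have "cmb v (\<lambda>i. of_int \<lfloor>c i\<rfloor>) \<in> P" using assms by (rule P_cmb)
  moreover have "cmb v (\<lambda>i. frac (c i)) = cmb v c - cmb v (\<lambda>i. of_int \<lfloor>c i\<rfloor>)"
    by (simp add: frac_def cmb_diff)
  ultimately show ?thesis by (metis P_add P_diff diff_add_cancel)
qed

text \<open>Gram entries are integers bounded by \<open>2 * M\<close>. By Cramer's rule, coordinates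
  of lattice points have denominators dividing the Gram determinant, which is at most
  \<open>24 * (2 * M) ^ 4\<close>; the factorial \<open>K\<close> is a common multiple of all
  possible determinants.\<close>

lemma frame_shape_mem:
  fixes M :: nat
  defines "K \<equiv> fact (24 * (2 * M) ^ 4)"
  assumes v: "frame v" "\<And>i. v i \<in> P" "\<And>i. Q (v i) \<le> of_nat M"
  shows "frame_shape L v \<in> (UNIV \<rightarrow>\<^sub>E (UNIV \<rightarrow>\<^sub>E of_int ` {- 2 * int M..2 * int M})) \<times>
    Pow (UNIV \<rightarrow>\<^sub>E (\<lambda>z. of_int z / of_int K) ` {0..K})"
proof -
  have bnd: "\<bar>2 * B (v i) (v j)\<bar> \<le> 2 * of_nat M" for i j
    using B_bound[of "v i" "v j"] v(3)[of i] v(3)[of j] by linarith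
  have int: "2 * B (v i) (v j) \<in> of_int ` {- 2 * int M..2 * int M}" for i j
  proof -
    obtain z where z: "2 * B (v i) (v j) = of_int z"
      using B_Ints[OF v(2) v(2), of i j] by (auto elim: Ints_cases)
    then have "(of_int \<bar>z\<bar> :: rat) \<le> of_int (2 * int M)" using bnd[of i j] by simp
    then have "\<bar>z\<bar> \<le> 2 * int M" unfolding of_int_le_iff .
    then show ?thesis unfolding z by (intro imageI) auto
  qed
  have "det (gram v) \<in> \<int>" by (rule det_Ints) (simp add: gram_def B_Ints v)
  then obtain \<delta> where \<delta>: "det (gram v) = of_int \<delta>" by (auto elim: Ints_cases)
  have "\<delta> \<noteq> 0" using det_gram_nonzero[OF v(1)] \<delta> by auto
  have "\<bar>det (gram v)\<bar> \<le> fact CARD(4) * (2 * of_nat M) ^ CARD(4)"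
    by (rule det_bound) (use bnd in \<open>simp add: gram_def\<close>)
  also have "\<dots> = of_int (int (24 * (2 * M) ^ 4))" by (simp add: fact_numeral)
  finally have "(of_int \<bar>\<delta>\<bar> :: rat) \<le> of_int (int (24 * (2 * M) ^ 4))" using \<delta> by simp
  then have "\<bar>\<delta>\<bar> \<le> int (24 * (2 * M) ^ 4)" unfolding of_int_le_iff .
  then have "nat \<bar>\<delta>\<bar> \<le> 24 * (2 * M) ^ 4" by linarith
  then have "nat \<bar>\<delta>\<bar> dvd fact (24 * (2 * M) ^ 4)" using \<open>\<delta> \<noteq> 0\<close> by (intro dvd_fact) auto
  then have "int (nat \<bar>\<delta>\<bar>) dvd int (fact (24 * (2 * M) ^ 4))" by (simp only: int_dvd_int_iff)
  then have "\<delta> dvd K" by (simp add: K_def)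
  then obtain r where r: "K = \<delta> * r" by (elim dvdE)
  have "K > 0" by (simp add: K_def)
  have "c i \<in> (\<lambda>z. of_int z / of_int K) ` {0..K}"
    if c: "\<forall>i. 0 \<le> c i \<and> c i < 1" "cmb v c \<in> P" for c i
  proof -
    have "c i * det (gram v) \<in> \<int>" using v(2) c(2) by (intro gram_cramer B_Ints)
    then have "c i * of_int \<delta> * of_int r \<in> \<int>" unfolding \<delta> by (rule Ints_mult) simp
    then have "c i * of_int K \<in> \<int>" by (simp add: r mult.assoc)
    then obtain z where z: "c i * of_int K = of_int z" by (auto elim: Ints_cases)
    have ci: "c i = of_int z / of_int K" using z \<open>K > 0\<close> by (simp add: field_simps)
    have "0 \<le> c i * of_int K" "c i * of_int K \<le> 1 * of_int K"
      using c(1) \<open>K > 0\<close> by (intro mult_nonneg_nonneg mult_right_mono; simp add: less_imp_le)+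
    then have "(of_int 0 :: rat) \<le> of_int z" "(of_int z :: rat) \<le> of_int K" unfolding z by auto
    then have "z \<in> {0..K}" unfolding of_int_le_iff by simp
    then show ?thesis unfolding ci by (rule imageI)
  qed
  then show ?thesis using int unfolding frame_shape_def by auto
qed

end

text \<open>The linear map sending \<open>v i\<close> to \<open>v' i\<close> preserves the form
  because the Gram matrices agree, and it matches the point sets because membership depends only on
  fractional parts of coordinates.\<close>

lemma frame_shape_isometric:
  assumes "quaternary_lattice L" "frame v" "\<And>i. v i \<in> points L"
    and "quaternary_lattice L'" "frame v'" "\<And>i. v' i \<in> points L'"
    and shape: "frame_shape L v = frame_shape L' v'"
  shows "(L, L') \<in> lattice_isometry"
proof -
  interpret L: quat_lattice L by unfold_locales fact
  interpret L': quat_lattice L' by unfold_locales fact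
  have gram: "bform L' (v' i) (v' j) = bform L (v i) (v j)" for i j
  proof -
    have "2 * bform L (v i) (v j) = 2 * bform L' (v' i) (v' j)"
      using shape unfolding frame_shape_def prod.inject by meson
    then show ?thesis by simp
  qed
  have mem: "cmb v c \<in> points L \<longleftrightarrow> cmb v' c \<in> points L'" for c
  proof -
    have "{c. (\<forall>i. 0 \<le> c i \<and> c i < 1) \<and> cmb v c \<in> points L}
        = {c. (\<forall>i. 0 \<le> c i \<and> c i < 1) \<and> cmb v' c \<in> points L'}"
      using shape unfolding frame_shape_def prod.inject by blast
    from eqset_imp_iff[OF this, of "\<lambda>i. frac (c i)"]
    have "cmb v (\<lambda>i. frac (c i)) \<in> points L \<longleftrightarrow> cmb v' (\<lambda>i. frac (c i)) \<in> points L'"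
      by (simp add: frac_lt_1)
    then show ?thesis using L.cmb_frac_in_P[of v c] L'.cmb_frac_in_P[of v' c] assms by simp
  qed
  have "vec.independent (range v)" using assms(2) by (simp add: frame_def)
  then obtain \<sigma> :: "rat ^ 4 \<Rightarrow> rat ^ 4" where \<sigma>: "Vector_Spaces.linear (*s) (*s) \<sigma>"
    and "\<forall>x\<in>range v. \<sigma> x = v' (inv_into UNIV v x)"
    using vec.linear_independent_extend[of "range v" "\<lambda>x. v' (inv_into UNIV v x)"] by blast
  then have \<sigma>_v: "\<sigma> (v i) = v' i" for i using assms(2) by (simp add: frame_def)
  have \<sigma>_add: "\<sigma> (x + y) = \<sigma> x + \<sigma> y" and \<sigma>_scale: "\<sigma> (r *s x) = r *s \<sigma> x" for x y r
    using \<sigma> by (auto simp: Vector_Spaces.linear_iff)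
  have "\<sigma> 0 = 0" using \<sigma>_scale[of 0 0] by simp
  then have \<sigma>_sum: "\<sigma> (\<Sum>i\<in>I. h i) = (\<Sum>i\<in>I. \<sigma> (h i))" for I :: "4 set" and h
    by (induction I rule: infinite_finite_induct) (simp_all add: \<sigma>_add)
  have \<sigma>_cmb: "\<sigma> (cmb v c) = cmb v' c" for c
    by (simp add: cmb_def \<sigma>_sum \<sigma>_scale \<sigma>_v)
  have coords: "\<exists>c. x = cmb v c" for x using frame_cmb_ex[OF assms(2)] by metis
  have coords': "\<exists>c. x = cmb v' c" for x using frame_cmb_ex[OF assms(5)] by metis
  have "bij \<sigma>"
  proof (rule bijI)
    show "inj \<sigma>"
    proof (rule injI)
      fix x y assume "\<sigma> x = \<sigma> y"
      moreover obtain c e where "x = cmb v c" "y = cmb v e" using coords by metis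
      ultimately show "x = y" using frame_cmb_inj[OF assms(5)] by (simp add: \<sigma>_cmb) blast
    qed
    show "surj \<sigma>"
    proof (rule surjI)
      show "\<sigma> (cmb v (SOME c. y = cmb v' c)) = y" for y
        using someI_ex[OF coords'[of y]] by (simp only: \<sigma>_cmb)
    qed
  qed
  moreover have "bform L' (\<sigma> x) (\<sigma> y) = bform L x y" for x y
  proof -
    obtain c e where "x = cmb v c" "y = cmb v e" using coords by metis
    then show ?thesis by (simp add: \<sigma>_cmb L.B_cmb_cmb L'.B_cmb_cmb gram)
  qed
  moreover have "\<sigma> ` points L = points L'"
  proof (intro equalityI subsetI)
    fix x assume "x \<in> \<sigma> ` points L"
    then obtain y where y: "y \<in> points L" "x = \<sigma> y" by blast
    obtain c where "y = cmb v c" using coords by blast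
    then show "x \<in> points L'" using y mem by (simp add: \<sigma>_cmb)
  next
    fix x assume x: "x \<in> points L'"
    obtain c where c: "x = cmb v' c" using coords' by blast
    then have "cmb v c \<in> points L" using x mem by simp
    then show "x \<in> \<sigma> ` points L" unfolding c \<sigma>_cmb[symmetric] by (rule imageI)
  qed
  ultimately show ?thesis unfolding lattice_isometry_def using \<sigma> by blast
qed

text \<open>Choose one bounded frame for each lattice: its shape takes finitely many values, and
  equal shapes force isometry.\<close>

lemma finite_bounded_frame_classes:
  fixes M :: nat
  shows "finite ({L. quaternary_lattice L \<and>
    (\<exists>v. frame v \<and> (\<forall>i. v i \<in> points L \<and> qmap L (v i) \<le> of_nat M))} // lattice_isometry)"
    (is "finite (?A // _)")
proof -
  obtain v where v: "\<And>L. L \<in> ?A \<Longrightarrow> frame (v L)" "\<And>L i. L \<in> ?A \<Longrightarrow> v L i \<in> points L"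
    "\<And>L i. L \<in> ?A \<Longrightarrow> qmap L (v L i) \<le> of_nat M"
  proof -
    have "\<forall>L\<in>?A. \<exists>v. frame v \<and> (\<forall>i. v i \<in> points L \<and> qmap L (v i) \<le> of_nat M)" by blast
    from bchoice[OF this] that show ?thesis by blast
  qed
  show ?thesis
  proof (rule finite_quotient_invariant[OF equiv_lattice_isometry])
    let ?K = "fact (24 * (2 * M) ^ 4) :: int"
    show "finite ((\<lambda>L. frame_shape L (v L)) ` ?A)"
    proof (rule finite_subset)
      show "(\<lambda>L. frame_shape L (v L)) ` ?A \<subseteq>
        (UNIV \<rightarrow>\<^sub>E (UNIV \<rightarrow>\<^sub>E of_int ` {- 2 * int M..2 * int M})) \<times>
        Pow (UNIV \<rightarrow>\<^sub>E (\<lambda>z. of_int z / of_int ?K) ` {0..?K})"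
      proof (rule image_subsetI)
        fix L assume L: "L \<in> ?A"
        then interpret quat_lattice L by unfold_locales simp
        show "frame_shape L (v L) \<in> (UNIV \<rightarrow>\<^sub>E (UNIV \<rightarrow>\<^sub>E of_int ` {- 2 * int M..2 * int M})) \<times>
          Pow (UNIV \<rightarrow>\<^sub>E (\<lambda>z. of_int z / of_int ?K) ` {0..?K})"
          using v[OF L] by (rule frame_shape_mem)
      qed
      show "finite ((UNIV \<rightarrow>\<^sub>E (UNIV \<rightarrow>\<^sub>E of_int ` {- 2 * int M..2 * int M})) \<times>
        Pow (UNIV \<rightarrow>\<^sub>E (\<lambda>z. of_int z / of_int ?K) ` {0..?K}) :: ((4 \<Rightarrow> 4 \<Rightarrow> rat) \<times> (4 \<Rightarrow> rat) set) set)"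
        by (intro finite_cartesian_product finite_PiE finite_imageI iffD2[OF finite_Pow_iff]) auto
    qed
    show "(L, L') \<in> lattice_isometry"
      if "L \<in> ?A" "L' \<in> ?A" "frame_shape L (v L) = frame_shape L' (v L')" for L L'
      using that v by (intro frame_shape_isometric[of L "v L" L' "v L'"]) auto
  qed
qed

theorem theorem3p8:
  fixes m :: nat
  assumes "m > 0"
  shows "finite ({L. quaternary_lattice L \<and> strongly_s_regular L \<and> min_square L = m} //
                   lattice_isometry)"
proof -
  obtain M :: nat where M: "\<And>L. quaternary_lattice L \<and> strongly_s_regular L \<and> min_square L = m \<Longrightarrow>
      \<exists>v. frame v \<and> (\<forall>i. v i \<in> points L \<and> qmap L (v i) \<le> of_nat M)"
    using regular_lattice_bounded_frame[OF assms] by blast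
  \<comment> \<open>The quotient consists of full isometry classes, so a smaller set of lattices
    gives a subset of the quotient.\<close>
  show ?thesis
    by (rule finite_subset[OF _ finite_bounded_frame_classes[of M]])
      (use M in \<open>auto simp: quotient_def\<close>)
qed

end
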